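(* Let $\mathbb{G},\mathbb{H}$ be sublattices of $\mathbb{Z}^d$ with $\mathbb{G}\oplus\mathbb{H}=\mathbb{Z}^d$, with bases $\mathbf{B}_{\mathbb{G}}$ and $\mathbf{B}_{\mathbb{H}}$. Let $\mathbf{T}\subset\mathcal{B}^{\mathbb{Z}^d}$ and $\mathbf{T}'\subset\mathcal{B}'^{\mathbb{Z}^d}$ be two sofic subshifts. If $\mathbf{T}$ and $\mathbf{T}'$ are conjugate, then there exist a subshift of finite type $\mathbf{T}_F\subset\mathcal{A}^{\mathbb{Z}^d}$ (with $F$ a finite set of forbidden patterns), two factor maps $\pi:\mathbf{T}_F\to\mathbf{T}$ and $\pi':\mathbf{T}_F\to\mathbf{T}'$, and $r,r'\in\mathbb{N}$ such that for all $k\in\mathbb{N}$ $$\varphi_{F,\pi,\mathbf{B}_{\mathbb{G}},\mathbf{B}_{\mathbb{H}}}(k)\leq\varphi_{\theta_{r'}(F),\pi',\mathbf{B}_{\mathbb{G}},\mathbf{B}_{\mathbb{H}}}(k+2r)\leq\varphi_{\theta_{2r'}(F),\pi,\mathbf{B}_{\mathbb{G}},\mathbf{B}_{\mathbb{H}}}(k+4r).$$ Moreover one can choose $r'=0$ if the neighborhood of the conjugacy is included in $\mathbb{G}$.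
   Context: Intervals $[a,b]$ are integer intervals. A subshift of $\mathcal{A}^{\mathbb{Z}^d}$ ($\mathcal{A}$ a finite alphabet) is a closed shift-invariant subset. A pattern is an element $p\in\mathcal{A}^{\mathbb{U}}$ with $\mathbb{U}\subset\mathbb{Z}^d$ finite; it appears in $x$ if $p=x_{\mathbf{i}+\mathbb{U}}$ for some $\mathbf{i}$. $\mathbf{T}_F$ is the set of configurations in which no pattern of $F$ appears; it is of finite type if $F$ is finite. $\mathcal{L}(X)$ is the set of patterns appearing in elements of $X$. A morphism is a continuous shift-commuting map; it is given by a local rule $\pi(x)_{\mathbf{i}}=\overline{\pi}(x_{\mathbf{i}+\mathbb{U}})$ with a finite neighborhood $\mathbb{U}$. A sofic subshift is the image of a subshift of finite type under a morphism. Two subshifts are conjugate if there is a bijective morphism (the conjugacy) between them. Factor maps $\mathbf{T}_F\to\mathbf{T}$ are here the surjective restrictions of morphisms of full shifts $\mathcal{A}^{\mathbb{Z}^d}\to\mathcal{B}^{\mathbb{Z}^d}$. Let $\mathbf{B}_{\mathbb{G}}=(\mathbf{u}_1,\dots,\mathbf{u}_{d'})$, $\mathbf{B}_{\mathbb{H}}=(\mathbf{v}_1,\dots,\mathbf{v}_{d''})$, and $\mathbb{B}_n=\{k_1\mathbf{v}_1+\dots+k_{d''}\mathbf{v}_{d''}:(k_1,\dots,k_{d''})\in[-n,n]^{d''}\}$. For finite $F$, $\mathbf{T}_F^{n}$ (the $n$-approximation row) is the set of $x\in\mathcal{A}^{\mathbb{G}+\mathbb{B}_n}$ in which no pattern of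 $F$ appears (only occurrences with support inside $\mathbb{G}+\mathbb{B}_n$ are considered). A morphism $\pi:\mathcal{A}^{\mathbb{Z}^d}\to\mathcal{B}^{\mathbb{Z}^d}$ is applied to such $x$ through its local rule, at those positions $\mathbf{i}$ with $\mathbf{i}+\mathbb{U}\subset\mathbb{G}+\mathbb{B}_n$. $\mathbf{SA}_{\mathbf{B}_{\mathbb{G}}}$ restricts a configuration to $\mathbb{G}$, identified with $\mathbb{Z}^{d'}$ by $\mathbf{B}_{\mathbb{G}}$. Speed of convergence: $\varphi_{F,\pi,\mathbf{B}_{\mathbb{G}},\mathbf{B}_{\mathbb{H}}}(k)$ is the least integer $n\geq1$, large enough that $\mathbf{SA}_{\mathbf{B}_{\mathbb{G}}}\circ\pi$ is defined on $\mathbf{T}_F^n$, such that every $u\in\mathcal{B}^{[0,k-1]^{d'}}$ with $u\notin\mathcal{L}(\mathbf{SA}_{\mathbf{B}_{\mathbb{G}}}(\pi(\mathbf{T}_F)))$ satisfies $u\notin\mathcal{L}(\mathbf{SA}_{\mathbf{B}_{\mathbb{G}}}(\pi(\mathbf{T}_F^n)))$. Speed of convergence with larger row: for $r\in\mathbb{N}$ let $\theta_r(x)=(x_{\mathbf{i}+\mathbb{B}_r})_{\mathbf{i}}$, a configuration over the alphabet of patterns of support $\mathbb{B}_r$. $\varphi_{\theta_r(F),\pi,\mathbf{B}_{\mathbb{G}},\mathbf{B}_{\mathbb{H}}}(k)$ is the speed of convergence of $\mathbf{T}_F$ for a row of size $r$: the least integer $n\geq1$, large enough that $\pi(x)$ is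 defined on $\mathbb{G}+\mathbb{B}_r$ for $x\in\mathbf{T}_F^n$, such that every $u\in(\mathcal{B}^{\mathbb{B}_r})^{[0,k-1]^{d'}}$ with $u\notin\mathcal{L}(\mathbf{SA}_{\mathbf{B}_{\mathbb{G}}}(\theta_r(\pi(\mathbf{T}_F))))$ satisfies $u\notin\mathcal{L}(\mathbf{SA}_{\mathbf{B}_{\mathbb{G}}}(\theta_r(\pi(\mathbf{T}_F^n))))$. For $r=0$ this is $\varphi_{F,\pi,\mathbf{B}_{\mathbb{G}},\mathbf{B}_{\mathbb{H}}}$.
   Formalization: In the "moreover", r'=0 is obtained when both the conjugacy and its inverse have a neighborhood included in G; with the neighborhood of the conjugacy alone the claim is false. *)

theory Defs
  imports "HOL-Analysis.Analysis" "HOL-Library.Function_Algebras"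
begin

section \<open>Configurations, patterns and subshifts\<close>

text \<open>
  \<open>\<int>\<^sup>d\<close> is \<open>int ^ 'd\<close>. Alphabets are finite sets, not types, because the alphabet of the
  subshift of finite type is existentially quantified; for that alphabet, finite sets of
  natural numbers represent all finite alphabets up to renaming.

  Elements of the full shift are total functions. Patterns and configurations on a subset of
  the lattice are partial maps whose domain is their support; a total configuration \<open>x\<close> is
  seen as the partial map \<open>Some \<circ> x\<close>.
\<close>

definition configs_top :: "'a set \<Rightarrow> ((int ^ 'd::finite) \<Rightarrow> 'a) topology" where
  "configs_top A = product_topology (\<lambda>_. discrete_topology A) UNIV"

definition full_shift :: "'a set \<Rightarrow> ((int ^ 'd::finite) \<Rightarrow> 'a) set" where
  "full_shift A = {x. \<forall>i. x i \<in> A}"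

definition shift :: "int ^ 'd::finite \<Rightarrow> (int ^ 'd \<Rightarrow> 'a) \<Rightarrow> (int ^ 'd \<Rightarrow> 'a)" where
  "shift i x = (\<lambda>j. x (i + j))"

definition subshift :: "'a set \<Rightarrow> ((int ^ 'd::finite) \<Rightarrow> 'a) set \<Rightarrow> bool" where
  "subshift A X \<longleftrightarrow> finite A \<and> closedin (configs_top A) X \<and> (\<forall>x\<in>X. \<forall>i. shift i x \<in> X)"

text \<open>The set \<open>A\<^sup>U\<close>.\<close>

definition maps_on :: "'i set \<Rightarrow> 'a set \<Rightarrow> ('i \<rightharpoonup> 'a) set" where
  "maps_on U A = {p. dom p = U \<and> ran p \<subseteq> A}"

text \<open>Since \<open>x\<close> must be defined on \<open>i + dom p\<close>, only occurrences whose support lies inside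
  \<open>dom x\<close> are considered.\<close>

definition appears :: "('i::plus \<rightharpoonup> 'a) \<Rightarrow> ('i \<rightharpoonup> 'a) \<Rightarrow> bool" where
  "appears p x \<longleftrightarrow> (\<exists>i. \<forall>u\<in>dom p. x (i + u) = p u)"

definition language :: "('i::plus \<rightharpoonup> 'a) set \<Rightarrow> ('i \<rightharpoonup> 'a) set" where
  "language X = {p. finite (dom p) \<and> (\<exists>x\<in>X. appears p x)}"

definition finite_patterns :: "'a set \<Rightarrow> (int ^ 'd::finite \<rightharpoonup> 'a) set \<Rightarrow> bool" where
  "finite_patterns A F \<longleftrightarrow> finite F \<and> (\<forall>p\<in>F. finite (dom p) \<and> ran p \<subseteq> A)"

definition forbid :: "'a set \<Rightarrow> (int ^ 'd::finite \<rightharpoonup> 'a) set \<Rightarrow> (int ^ 'd \<Rightarrow> 'a) set" where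
  "forbid A F = {x \<in> full_shift A. \<forall>p\<in>F. \<not> appears p (Some \<circ> x)}"


section \<open>Morphisms\<close>

definition morphism ::
  "'a set \<Rightarrow> (int ^ 'd::finite \<Rightarrow> 'a) set \<Rightarrow> 'b set \<Rightarrow> (int ^ 'd \<Rightarrow> 'b) set
    \<Rightarrow> ((int ^ 'd \<Rightarrow> 'a) \<Rightarrow> (int ^ 'd \<Rightarrow> 'b)) \<Rightarrow> bool" where
  "morphism A X B Y f \<longleftrightarrow>
     continuous_map (subtopology (configs_top A) X) (subtopology (configs_top B) Y) f \<and>
     (\<forall>x\<in>X. \<forall>i. f (shift i x) = shift i (f x))"

definition conjugacy ::
  "'a set \<Rightarrow> (int ^ 'd::finite \<Rightarrow> 'a) set \<Rightarrow> 'b set \<Rightarrow> (int ^ 'd \<Rightarrow> 'b) set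
    \<Rightarrow> ((int ^ 'd \<Rightarrow> 'a) \<Rightarrow> (int ^ 'd \<Rightarrow> 'b)) \<Rightarrow> bool" where
  "conjugacy A X B Y f \<longleftrightarrow> morphism A X B Y f \<and> bij_betw f X Y"

definition sofic :: "'b set \<Rightarrow> (int ^ 'd::finite \<Rightarrow> 'b) set \<Rightarrow> bool" where
  "sofic B T \<longleftrightarrow> subshift B T \<and>
     (\<exists>(A :: nat set) F f. finite A \<and> finite_patterns A F \<and>
        morphism A (forbid A F) B T f \<and> f ` forbid A F = T)"

definition factor_map ::
  "'a set \<Rightarrow> (int ^ 'd::finite \<Rightarrow> 'a) set \<Rightarrow> 'b set \<Rightarrow> (int ^ 'd \<Rightarrow> 'b) set
    \<Rightarrow> ((int ^ 'd \<Rightarrow> 'a) \<Rightarrow> (int ^ 'd \<Rightarrow> 'b)) \<Rightarrow> bool" where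
  "factor_map A X B T f \<longleftrightarrow> morphism A (full_shift A) B (full_shift B) f \<and> f ` X = T"

text \<open>\<open>window U x i\<close> is \<open>x\<^bsub>i+U\<^esub>\<close>, translated to the support \<open>U\<close>.\<close>

definition window :: "'i::plus set \<Rightarrow> ('i \<rightharpoonup> 'a) \<Rightarrow> 'i \<Rightarrow> ('i \<rightharpoonup> 'a)" where
  "window U x i = (\<lambda>u. x (i + u)) |` U"

definition has_local_rule ::
  "(int ^ 'd::finite \<Rightarrow> 'a) set \<Rightarrow> ((int ^ 'd \<Rightarrow> 'a) \<Rightarrow> (int ^ 'd \<Rightarrow> 'b))
    \<Rightarrow> (int ^ 'd) set \<Rightarrow> ((int ^ 'd \<rightharpoonup> 'a) \<Rightarrow> 'b) \<Rightarrow> bool" where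
  "has_local_rule X f U g \<longleftrightarrow> finite U \<and> (\<forall>x\<in>X. \<forall>i. f x i = g (window U (Some \<circ> x) i))"

definition neighborhood ::
  "(int ^ 'd::finite \<Rightarrow> 'a) set \<Rightarrow> ((int ^ 'd \<Rightarrow> 'a) \<Rightarrow> (int ^ 'd \<Rightarrow> 'b))
    \<Rightarrow> (int ^ 'd) set \<Rightarrow> bool" where
  "neighborhood X f U \<longleftrightarrow> (\<exists>g. has_local_rule X f U g)"

text \<open>The action of a local rule on a configuration with arbitrary support.\<close>

definition local_map ::
  "'i::plus set \<Rightarrow> (('i \<rightharpoonup> 'a) \<Rightarrow> 'b) \<Rightarrow> ('i \<rightharpoonup> 'a) \<Rightarrow> ('i \<rightharpoonup> 'b)" where
  "local_map U g x = (\<lambda>i. if \<forall>u\<in>U. i + u \<in> dom x then Some (g (window U x i)) else None)"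


section \<open>Sublattices and rows\<close>

definition lattice_basis :: "(int ^ 'd::finite) set \<Rightarrow> (int ^ 'd) list \<Rightarrow> bool" where
  "lattice_basis G us \<longleftrightarrow>
     distinct us \<and> \<not> module.dependent (*s) (set us) \<and> module.span (*s) (set us) = G"

definition direct_sum :: "(int ^ 'd::finite) set \<Rightarrow> (int ^ 'd) set \<Rightarrow> bool" where
  "direct_sum G H \<longleftrightarrow> {g + h |g h. g \<in> G \<and> h \<in> H} = UNIV \<and> G \<inter> H = {0}"

text \<open>\<open>\<int>\<^sup>m\<close> for \<open>m\<close> the rank of a sublattice, which may be \<open>0\<close>.\<close>

definition coords :: "nat \<Rightarrow> (nat \<Rightarrow> int) set" where
  "coords m = {k. \<forall>i\<ge>m. k i = 0}"

definition comb :: "(int ^ 'd::finite) list \<Rightarrow> (nat \<Rightarrow> int) \<Rightarrow> int ^ 'd" where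
  "comb us k = (\<Sum>i<length us. k i *s us ! i)"

definition cube :: "nat \<Rightarrow> nat \<Rightarrow> (nat \<Rightarrow> int) set" where
  "cube m k = {t \<in> coords m. \<forall>i<m. 0 \<le> t i \<and> t i \<le> int k - 1}"

text \<open>The sets \<open>\<bbbB>\<^sub>n\<close> and \<open>\<bbbG> + \<bbbB>\<^sub>n\<close>.\<close>

definition row_box :: "(int ^ 'd::finite) list \<Rightarrow> nat \<Rightarrow> (int ^ 'd) set" where
  "row_box vs n = comb vs ` {k \<in> coords (length vs). \<forall>i<length vs. - int n \<le> k i \<and> k i \<le> int n}"

definition strip :: "(int ^ 'd::finite) set \<Rightarrow> (int ^ 'd) list \<Rightarrow> nat \<Rightarrow> (int ^ 'd) set" where
  "strip G vs n = {g + b |g b. g \<in> G \<and> b \<in> row_box vs n}"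

definition approx_row ::
  "(int ^ 'd::finite) set \<Rightarrow> (int ^ 'd) list \<Rightarrow> 'a set \<Rightarrow> (int ^ 'd \<rightharpoonup> 'a) set \<Rightarrow> nat
    \<Rightarrow> (int ^ 'd \<rightharpoonup> 'a) set" where
  "approx_row G vs A F n = {x \<in> maps_on (strip G vs n) A. \<forall>p\<in>F. \<not> appears p x}"

definition SA :: "(int ^ 'd::finite) list \<Rightarrow> (int ^ 'd \<rightharpoonup> 'a) \<Rightarrow> ((nat \<Rightarrow> int) \<rightharpoonup> 'a)" where
  "SA us x = (\<lambda>t. if t \<in> coords (length us) then x (comb us t) else None)"

definition theta ::
  "(int ^ 'd::finite) list \<Rightarrow> nat \<Rightarrow> (int ^ 'd \<rightharpoonup> 'b) \<Rightarrow> (int ^ 'd \<rightharpoonup> (int ^ 'd \<rightharpoonup> 'b))" where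
  "theta vs r = local_map (row_box vs r) (\<lambda>p. p)"


section \<open>Speed of convergence\<close>

text \<open>
  In \<open>speed_on\<close>, \<open>(U, g)\<close> is the local rule, \<open>D\<close> the set of positions at which its image has
  to be defined, \<open>obs\<close> the map applied to this image before restricting to the sublattice, and
  \<open>C\<close> the alphabet of the result. By compactness the least \<open>n\<close> exists whenever
  \<open>A\<close>, \<open>C\<close>, \<open>F\<close> and \<open>U\<close> are finite, in the two instances below.
\<close>

definition speed_on ::
  "(int ^ 'd::finite) set \<Rightarrow> (int ^ 'd) set \<Rightarrow> ((int ^ 'd \<rightharpoonup> 'b) \<Rightarrow> (int ^ 'd \<rightharpoonup> 'c)) \<Rightarrow> 'c set
    \<Rightarrow> (int ^ 'd) list \<Rightarrow> (int ^ 'd) list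
    \<Rightarrow> 'a set \<Rightarrow> (int ^ 'd \<rightharpoonup> 'a) set \<Rightarrow> (int ^ 'd) set \<Rightarrow> ((int ^ 'd \<rightharpoonup> 'a) \<Rightarrow> 'b)
    \<Rightarrow> nat \<Rightarrow> nat" where
  "speed_on G D obs C us vs A F U g k =
     (LEAST n. n \<ge> 1 \<and> (\<forall>i\<in>D. \<forall>u\<in>U. i + u \<in> strip G vs n) \<and>
        (\<forall>w\<in>maps_on (cube (length us) k) C.
           w \<notin> language ((\<lambda>x. SA us (obs (local_map U g (Some \<circ> x)))) ` forbid A F) \<longrightarrow>
           w \<notin> language ((\<lambda>x. SA us (obs (local_map U g x))) ` approx_row G vs A F n)))"

definition speed ::
  "(int ^ 'd::finite) set \<Rightarrow> (int ^ 'd) list \<Rightarrow> (int ^ 'd) list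
    \<Rightarrow> 'a set \<Rightarrow> (int ^ 'd \<rightharpoonup> 'a) set \<Rightarrow> 'b set \<Rightarrow> (int ^ 'd) set
    \<Rightarrow> ((int ^ 'd \<rightharpoonup> 'a) \<Rightarrow> 'b) \<Rightarrow> nat \<Rightarrow> nat" where
  "speed G us vs A F B U g = speed_on G G (\<lambda>y. y) B us vs A F U g"

definition speed_row ::
  "nat \<Rightarrow> (int ^ 'd::finite) set \<Rightarrow> (int ^ 'd) list \<Rightarrow> (int ^ 'd) list
    \<Rightarrow> 'a set \<Rightarrow> (int ^ 'd \<rightharpoonup> 'a) set \<Rightarrow> 'b set \<Rightarrow> (int ^ 'd) set
    \<Rightarrow> ((int ^ 'd \<rightharpoonup> 'a) \<Rightarrow> 'b) \<Rightarrow> nat \<Rightarrow> nat" where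
  "speed_row r G us vs A F B U g =
     speed_on G (strip G vs r) (theta vs r) (maps_on (row_box vs r) B) us vs A F U g"

end

theory Submission
  imports Defs
begin

text \<open>
  By the Curtis--Hedlund--Lyndon theorem the conjugacy \<open>\<psi>\<close>, its inverse and a cover of \<open>\<bold>T\<close> by a
  subshift of finite type are given by local rules; let \<open>\<pi>\<close> be the cover and \<open>\<pi>' = \<psi> \<circ> \<pi>\<close>, both
  extended to the full shift through their local rules. Forbidding in addition the finitely many
  patterns on which the rule of \<open>\<psi>\<^sup>-\<^sup>1\<close> applied to \<open>\<pi>'\<close> differs from \<open>\<pi>\<close> does not change the subshift
  of finite type, but makes \<open>\<pi>\<close> a local function of \<open>\<pi>'\<close> on the approximation rows as well. If the
  neighborhoods of \<open>\<psi>\<close> and \<open>\<psi>\<^sup>-\<^sup>1\<close> have extent \<open>r\<close> along \<open>\<bbbG>\<close> and \<open>r'\<close> along \<open>\<bbbH>\<close>, a word for one map is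
  determined by a word for the other that is longer by \<open>2r\<close> and whose row is larger by \<open>r'\<close>. Hence
  an \<open>n\<close> that suffices for the larger words suffices for the smaller ones. Compactness provides
  such an \<open>n\<close>, so that the least ones can be compared.
\<close>


section \<open>Topology of the full shift\<close>

lemma topspace_configs_top [simp]: "topspace (configs_top A) = full_shift A"
  by (auto simp: configs_top_def full_shift_def)

lemma compact_space_configs_top: "finite A \<Longrightarrow> compact_space (configs_top A)"
  by (simp add: configs_top_def compact_space_product_topology compact_space_discrete_topology)

lemma Hausdorff_space_configs_top: "Hausdorff_space (configs_top A)"
  by (simp add: configs_top_def Hausdorff_space_product_topology)

lemma openin_cylinder:
  assumes "finite U"
  shows "openin (configs_top A) {y \<in> full_shift A. \<forall>u\<in>U. y u = x u}"
proof -
  \<comment> \<open>\<open>x\<close> may take values outside \<open>A\<close>; intersecting each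
    singleton with \<open>A\<close> keeps every factor open in the discrete space on
    \<open>A\<close>.\<close>
  have "{y \<in> full_shift A. \<forall>u\<in>U. y u = x u} =
      (\<Pi>\<^sub>E i\<in>UNIV. if i \<in> U then {x i} \<inter> A else A)"
    by (auto simp: full_shift_def PiE_def Pi_def)
  moreover have "finite {i. (if i \<in> U then {x i} \<inter> A else A) \<noteq> A}"
    by (rule finite_subset[OF _ assms]) auto
  ultimately show ?thesis
    unfolding configs_top_def by (simp only:) (intro product_topology_basis, auto)
qed

text \<open>Together with \<open>openin_configs_topD\<close> this turns openness into agreement on
  finite sets of coordinates, the form in which it is used below.\<close>

lemma openin_configs_topI:
  assumes "S \<subseteq> full_shift A"
    and "\<And>x. x \<in> S \<Longrightarrow> \<exists>U. finite U \<and> (\<forall>y\<in>full_shift A. (\<forall>u\<in>U. y u = x u) \<longrightarrow> y \<in> S)"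
  shows "openin (configs_top A) S"
proof (subst openin_subopen, intro ballI)
  fix x assume x: "x \<in> S"
  then obtain U where "finite U" "\<forall>y\<in>full_shift A. (\<forall>u\<in>U. y u = x u) \<longrightarrow> y \<in> S"
    using assms(2) by blast
  then show "\<exists>V. openin (configs_top A) V \<and> x \<in> V \<and> V \<subseteq> S"
    using openin_cylinder[of U A x] x assms(1)
    by (intro exI[of _ "{y \<in> full_shift A. \<forall>u\<in>U. y u = x u}"]) auto
qed

lemma openin_configs_topD:
  fixes x :: "int ^ 'd::finite \<Rightarrow> 'a"
  assumes "openin (configs_top A) S" "x \<in> S"
  shows "\<exists>U. finite U \<and> (\<forall>y\<in>full_shift A. (\<forall>u\<in>U. y u = x u) \<longrightarrow> y \<in> S)"
proof -
  obtain X where X: "x \<in> (\<Pi>\<^sub>E i\<in>UNIV. X i)" "finite {i. X i \<noteq> A}" "(\<Pi>\<^sub>E i\<in>UNIV. X i) \<subseteq> S"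
    using product_topology_open_contains_basis[OF assms[unfolded configs_top_def]] by auto
  have "y \<in> S" if "y \<in> full_shift A" "\<forall>u\<in>{i. X i \<noteq> A}. y u = x u" for y
  proof -
    have "y i \<in> X i" for i
      using that X(1) by (cases "X i = A") (auto simp: full_shift_def)
    then show ?thesis using X(3) by auto
  qed
  then show ?thesis using X(2) by blast
qed

lemma closedin_configs_topI:
  assumes "S \<subseteq> full_shift A"
    and "\<And>x. x \<in> full_shift A \<Longrightarrow> x \<notin> S \<Longrightarrow>
      \<exists>U. finite U \<and> (\<forall>y\<in>full_shift A. (\<forall>u\<in>U. y u = x u) \<longrightarrow> y \<notin> S)"
  shows "closedin (configs_top A) S"
  unfolding closedin_def using assms
  by (auto intro!: openin_configs_topI)

text \<open>A violation is visible on the finite translate \<open>i + dom p\<close>, so the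
  complement is open. The guard \<open>Q\<close> selects the positions that are tested: all of them
  for a subshift of finite type, those with support in a strip for its approximation rows.\<close>

lemma closedin_avoiding:
  fixes F :: "(int ^ 'd::finite \<rightharpoonup> 'a) set"
  assumes "\<And>p. p \<in> F \<Longrightarrow> finite (dom p)"
  shows "closedin (configs_top A)
    {x \<in> full_shift A. \<forall>p\<in>F. \<forall>i. Q p i \<longrightarrow> (\<exists>u\<in>dom p. Some (x (i + u)) \<noteq> p u)}"
proof (rule closedin_configs_topI)
  fix x :: "int ^ 'd \<Rightarrow> 'a"
  assume x: "x \<in> full_shift A"
    "x \<notin> {x \<in> full_shift A. \<forall>p\<in>F. \<forall>i. Q p i \<longrightarrow> (\<exists>u\<in>dom p. Some (x (i + u)) \<noteq> p u)}"
  then obtain p i where p: "p \<in> F" "Q p i" "\<forall>u\<in>dom p. Some (x (i + u)) = p u" by auto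
  show "\<exists>U. finite U \<and> (\<forall>y\<in>full_shift A. (\<forall>u\<in>U. y u = x u) \<longrightarrow>
      y \<notin> {x \<in> full_shift A. \<forall>p\<in>F. \<forall>i. Q p i \<longrightarrow> (\<exists>u\<in>dom p. Some (x (i + u)) \<noteq> p u)})"
    using p assms[of p] by (intro exI[of _ "(+) i ` dom p"]) (auto, metis)
qed auto

lemma closedin_forbid:
  assumes "finite_patterns A F"
  shows "closedin (configs_top A) (forbid A F)"
proof -
  have "forbid A F =
      {x \<in> full_shift A. \<forall>p\<in>F. \<forall>i. True \<longrightarrow> (\<exists>u\<in>dom p. Some (x (i + u)) \<noteq> p u)}"
    by (auto simp: forbid_def appears_def)
  then show ?thesis
    using closedin_avoiding[of F A "\<lambda>_ _. True"] assms by (simp add: finite_patterns_def)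
qed


section \<open>The Curtis--Hedlund--Lyndon theorem\<close>

lemma window_shift: "window U (Some \<circ> shift i x) j = window U (Some \<circ> x) (i + j)"
  by (rule ext) (auto simp: window_def shift_def restrict_map_def add.assoc)

lemma shift_in_forbid:
  assumes "x \<in> forbid A F"
  shows "shift i x \<in> forbid A F"
proof -
  have "\<not> appears p (Some \<circ> shift i x)" if "p \<in> F" for p
  proof
    assume "appears p (Some \<circ> shift i x)"
    then obtain j where "\<forall>u\<in>dom p. Some (x ((i + j) + u)) = p u"
      by (auto simp: appears_def shift_def add.assoc)
    then have "appears p (Some \<circ> x)" unfolding appears_def by (metis comp_apply)
    then show False using assms that by (simp add: forbid_def)
  qed
  then show ?thesis using assms by (simp add: forbid_def full_shift_def shift_def)
qed

lemma window_eqD: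
  assumes "window U (Some \<circ> x) i = window U (Some \<circ> y) j" "u \<in> U"
  shows "x (i + u) = y (j + u)"
  using fun_cong[OF assms(1), of u] assms(2) by (simp add: window_def)

text \<open>Near each point of \<open>X\<close> the symbol of the image at the origin depends on
  finitely many coordinates. By compactness finitely many such cylinders cover \<open>X\<close>, and
  the union of their supports is a neighborhood. Shift commutation carries the rule from the origin
  to all positions.\<close>

theorem morphism_has_local_rule:
  fixes f :: "(int ^ 'd::finite \<Rightarrow> 'a) \<Rightarrow> (int ^ 'd \<Rightarrow> 'b)"
  assumes "finite A" and clo: "closedin (configs_top A) X"
    and inv: "\<And>x i. x \<in> X \<Longrightarrow> shift i x \<in> X"
    and f: "morphism A X B Y f"
  shows "\<exists>U g. has_local_rule X f U g"
proof -
  have XA: "X \<subseteq> full_shift A" using closedin_subset[OF clo] by simp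
  have cpt: "compactin (configs_top A) X"
    using closedin_compact_space[OF compact_space_configs_top[OF \<open>finite A\<close>] clo] .
  have tX: "topspace (subtopology (configs_top A) X) = X" using XA by auto
  have cont: "continuous_map (subtopology (configs_top A) X) (subtopology (configs_top B) Y) f"
    and comm: "\<And>x i. x \<in> X \<Longrightarrow> f (shift i x) = shift i (f x)"
    using f by (auto simp: morphism_def)
  have fB: "f x \<in> full_shift B" if "x \<in> X" for x
    using continuous_map_image_subset_topspace[OF cont] that tX by auto
  have "\<exists>V. finite V \<and> (\<forall>y\<in>X. (\<forall>u\<in>V. y u = x u) \<longrightarrow> f y 0 = f x 0)" if x: "x \<in> X" for x
  proof -
    have "continuous_map (subtopology (configs_top A) X) (configs_top B) f"
      using cont by (simp add: continuous_map_in_subtopology)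
    then have "openin (subtopology (configs_top A) X)
        {y \<in> X. f y \<in> {z \<in> full_shift B. \<forall>u\<in>{0}. z u = f x u}}"
      using openin_continuous_map_preimage[OF _ openin_cylinder[of "{0}" B "f x"]] tX by fastforce
    then obtain O' where O': "openin (configs_top A) O'"
        "{y \<in> X. f y \<in> {z \<in> full_shift B. \<forall>u\<in>{0}. z u = f x u}} = O' \<inter> X"
      by (auto simp: openin_subtopology)
    have "x \<in> O'" using O'(2) x fB[OF x] by auto
    from openin_configs_topD[OF O'(1) this] obtain V where
      V: "finite V" "\<forall>y\<in>full_shift A. (\<forall>u\<in>V. y u = x u) \<longrightarrow> y \<in> O'" by blast
    have "f y 0 = f x 0" if "y \<in> X" "\<forall>u\<in>V. y u = x u" for y
    proof -
      have "y \<in> O' \<inter> X" using V that XA by auto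
      then show ?thesis using O'(2) by auto
    qed
    then show ?thesis using V(1) by blast
  qed
  then obtain V where V: "\<And>x. x \<in> X \<Longrightarrow> finite (V x)"
    "\<And>x y. x \<in> X \<Longrightarrow> y \<in> X \<Longrightarrow> (\<forall>u\<in>V x. y u = x u) \<Longrightarrow> f y 0 = f x 0"
    by metis
  let ?C = "\<lambda>x. {y \<in> full_shift A. \<forall>u\<in>V x. y u = x u}"
  have "X \<subseteq> \<Union>(?C ` X)" using XA by auto
  moreover have "openin (configs_top A) O'" if "O' \<in> ?C ` X" for O'
    using that V(1) openin_cylinder by blast
  ultimately have "\<exists>\<F>. finite \<F> \<and> \<F> \<subseteq> ?C ` X \<and> X \<subseteq> \<Union>\<F>"
    using compactinD[OF cpt, of "?C ` X"] by blast
  then obtain \<F> where \<F>: "finite \<F>" "\<F> \<subseteq> ?C ` X" "X \<subseteq> \<Union>\<F>" by blast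
  obtain X0 where X0': "X0 \<subseteq> X" "finite X0" "\<F> = ?C ` X0"
    using finite_subset_image[OF \<F>(1,2)] by auto
  have X0: "finite X0" "X0 \<subseteq> X" "X \<subseteq> (\<Union>x\<in>X0. ?C x)"
    using X0' \<F>(3) by auto
  define U where "U = (\<Union>x\<in>X0. V x)"
  have U: "f y 0 = f z 0"
    if yz: "y \<in> X" "z \<in> X" and eq: "window U (Some \<circ> y) 0 = window U (Some \<circ> z) 0" for y z
  proof -
    obtain x where x: "x \<in> X0" "\<forall>u\<in>V x. y u = x u" using X0(3) yz(1) by blast
    have "\<forall>u\<in>V x. z u = x u"
    proof
      fix u assume u: "u \<in> V x"
      then have "y (0 + u) = z (0 + u)" using x(1) by (intro window_eqD[OF eq]) (auto simp: U_def)
      then show "z u = x u" using x(2) u by simp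
    qed
    then have "f z 0 = f x 0" "f y 0 = f x 0" using V(2) x yz X0(2) by blast+
    then show ?thesis by simp
  qed
  \<comment> \<open>By the fact \<open>U\<close>, any configuration of \<open>X\<close> showing the
    pattern yields the same symbol; on patterns that do not occur in \<open>X\<close> the value is
    arbitrary.\<close>
  define g where "g p = f (SOME x. x \<in> X \<and> window U (Some \<circ> x) 0 = p) 0" for p
  have "f x i = g (window U (Some \<circ> x) i)" if x: "x \<in> X" for x i
  proof -
    let ?P = "\<lambda>y. y \<in> X \<and> window U (Some \<circ> y) 0 = window U (Some \<circ> x) i"
    have sx: "?P (shift i x)" using inv[OF x] by (simp add: window_shift)
    then have "?P (SOME y. ?P y)" by (rule someI[of ?P])
    then have "f (SOME y. ?P y) 0 = f (shift i x) 0"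
      by (intro U) (use sx in auto)
    then show ?thesis using comm[OF x] by (simp add: g_def shift_def)
  qed
  moreover have "finite U" using X0 V(1) by (auto simp: U_def)
  ultimately show ?thesis unfolding has_local_rule_def by blast
qed

text \<open>A continuous bijection from a compact space onto a Hausdorff space is a homeomorphism,
  and injectivity transfers shift commutation to the inverse.\<close>

lemma conjugacy_inverse:
  assumes "subshift A X" "subshift B Y" "conjugacy A X B Y f"
  shows "conjugacy B Y A X (inv_into X f)"
proof -
  have X: "finite A" "closedin (configs_top A) X" "\<And>x i. x \<in> X \<Longrightarrow> shift i x \<in> X"
    and Y: "closedin (configs_top B) Y"
    using assms by (auto simp: subshift_def)
  have f: "continuous_map (subtopology (configs_top A) X) (subtopology (configs_top B) Y) f"
    "\<And>x i. x \<in> X \<Longrightarrow> f (shift i x) = shift i (f x)" "bij_betw f X Y"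
    using assms(3) by (auto simp: conjugacy_def morphism_def)
  have inj: "inj_on f X" and img: "f ` X = Y" using f(3) by (auto simp: bij_betw_def)
  have t: "topspace (subtopology (configs_top A) X) = X" "topspace (subtopology (configs_top B) Y) = Y"
    using closedin_subset[OF X(2)] closedin_subset[OF Y] by auto
  have "compact_space (subtopology (configs_top A) X)"
    using closedin_compact_space[OF compact_space_configs_top[OF X(1)] X(2)]
    by (simp add: compact_space_subtopology)
  then have "homeomorphic_map (subtopology (configs_top A) X) (subtopology (configs_top B) Y) f"
    using f inj img t Hausdorff_space_subtopology[OF Hausdorff_space_configs_top]
    by (intro continuous_imp_homeomorphic_map) auto
  then obtain h where h: "continuous_map (subtopology (configs_top B) Y) (subtopology (configs_top A) X) h"
    "\<forall>x\<in>X. h (f x) = x" 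
    unfolding homeomorphic_map_maps homeomorphic_maps_def t by blast
  have hY: "h y = inv_into X f y" if "y \<in> Y" for y
    using that img h(2) inj by (metis f_inv_into_f inv_into_into)
  have "continuous_map (subtopology (configs_top B) Y) (subtopology (configs_top A) X) (inv_into X f)"
    using continuous_map_eq[OF h(1)] hY t by simp
  moreover have "inv_into X f (shift i y) = shift i (inv_into X f y)" if "y \<in> Y" for y i
  proof -
    have x: "inv_into X f y \<in> X" "f (inv_into X f y) = y"
      using that img by (auto intro: inv_into_into simp: f_inv_into_f)
    then have "shift i y = f (shift i (inv_into X f y))" using f(2) by simp
    then show ?thesis using X(3)[OF x(1)] inj by simp
  qed
  ultimately show ?thesis
    using bij_betw_inv_into[OF f(3)] by (simp add: conjugacy_def morphism_def)
qed

text \<open>Continuity is tested coordinate by coordinate, and the symbol at \<open>i\<close>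
  depends only on the finite translate \<open>i + U\<close>.\<close>

lemma local_rule_morphism:
  assumes "finite U"
    and "\<And>x i. x \<in> full_shift A \<Longrightarrow> g (window U (Some \<circ> x) i) \<in> B"
  shows "morphism A (full_shift A) B (full_shift B) (\<lambda>x i. g (window U (Some \<circ> x) i))"
  unfolding morphism_def
proof (intro conjI ballI allI)
  let ?f = "\<lambda>x i. g (window U (Some \<circ> x) i)"
  have "continuous_map (configs_top A) (discrete_topology B) (\<lambda>x. ?f x i)" for i
  proof (clarsimp simp: continuous_map_def, intro conjI allI impI)
    show "(\<lambda>x. ?f x i) \<in> full_shift A \<rightarrow> B" using assms(2) by auto
    fix S assume "S \<subseteq> B"
    have w: "window U (Some \<circ> y) i = window U (Some \<circ> x) i" if "\<forall>u\<in>(+) i ` U. y u = x u" for x y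
      using that by (auto simp: window_def restrict_map_def)
    show "openin (configs_top A) {x \<in> full_shift A. ?f x i \<in> S}"
    proof (rule openin_configs_topI)
      fix x assume "x \<in> {x \<in> full_shift A. ?f x i \<in> S}"
      moreover have "y \<in> {x \<in> full_shift A. ?f x i \<in> S}"
        if "y \<in> full_shift A" "\<forall>u\<in>(+) i ` U. y u = x u" for y
        using w[OF that(2)] that(1) calculation by simp
      ultimately show "\<exists>V. finite V \<and> (\<forall>y\<in>full_shift A. (\<forall>u\<in>V. y u = x u) \<longrightarrow>
          y \<in> {x \<in> full_shift A. ?f x i \<in> S})"
        using assms(1) by (intro exI[of _ "(+) i ` U"]) blast
    qed auto
  qed
  then have ct: "continuous_map (configs_top A) (configs_top B) ?f"
    by (simp add: configs_top_def[of B] continuous_map_componentwise_UNIV)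
  then show "continuous_map (subtopology (configs_top A) (full_shift A))
      (subtopology (configs_top B) (full_shift B)) ?f"
    using assms(2) by (auto simp: continuous_map_in_subtopology full_shift_def
        intro!: continuous_map_from_subtopology[OF ct])
next
  fix x i
  show "(\<lambda>j. g (window U (Some \<circ> shift i x) j)) = shift i (\<lambda>j. g (window U (Some \<circ> x) j))"
    by (simp only: window_shift) (simp add: shift_def)
qed


section \<open>Sublattices, boxes and strips\<close>

text \<open>\<open>lattice_basis\<close> is phrased with the generic span of a module; this opens
  that theory for integer coefficients.\<close>

lemma module_int_vec: "module ((*s) :: int \<Rightarrow> int ^ 'd::finite \<Rightarrow> int ^ 'd)"
  by unfold_locales (auto simp: vec_eq_iff algebra_simps)

text \<open>Distinctness allows coefficients indexed by the basis vectors to be reindexed by list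
  positions; they are set to 0 beyond the length of the list.\<close>

lemma lattice_basis_eq:
  assumes "lattice_basis G us"
  shows "G = comb us ` coords (length us)"
proof -
  interpret module "(*s) :: int \<Rightarrow> int ^ 'd \<Rightarrow> int ^ 'd" by (rule module_int_vec)
  have us: "distinct us" "G = span (set us)" using assms by (auto simp: lattice_basis_def)
  show ?thesis
  proof (intro equalityI subsetI)
    fix z assume "z \<in> G"
    then obtain f where f: "z = (\<Sum>v\<in>set us. f v *s v)" by (auto simp: us span_finite)
    define c where "c i = (if i < length us then f (us ! i) else 0)" for i
    have "(\<Sum>i<length us. f (us ! i) *s us ! i) = z"
      unfolding f using sum.reindex_bij_betw[OF bij_betw_nth[OF us(1) refl refl], of "\<lambda>v. f v *s v"]
      by simp
    then have "z = comb us c" by (simp add: comb_def c_def)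
    moreover have "c \<in> coords (length us)" by (auto simp: coords_def c_def)
    ultimately show "z \<in> comb us ` coords (length us)" by blast
  next
    fix z assume "z \<in> comb us ` coords (length us)"
    then obtain c where "z = (\<Sum>i<length us. c i *s us ! i)" by (auto simp: comb_def)
    moreover have "us ! i \<in> span (set us)" if "i < length us" for i
      using that by (simp add: span_base)
    ultimately show "z \<in> G" unfolding us(2) by (auto intro!: span_sum span_scale)
  qed
qed

lemma comb_add: "comb us (i + j) = comb us i + comb us j"
  by (simp add: comb_def vector_sadd_rdistrib sum.distrib)

lemma comb_zero [simp]: "comb us 0 = 0"
  by (simp add: comb_def)

lemma coords_add [intro]: "i \<in> coords m \<Longrightarrow> j \<in> coords m \<Longrightarrow> i + j \<in> coords m"
  and coords_diff [intro]: "i \<in> coords m \<Longrightarrow> j \<in> coords m \<Longrightarrow> i - j \<in> coords m"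
  and coords_zero [simp]: "0 \<in> coords m"
  by (auto simp: coords_def)

lemma finite_coords_box: "finite {t \<in> coords m. \<forall>i<m. a \<le> t i \<and> t i \<le> b}"
proof (rule finite_subset)
  show "finite {t. \<forall>i. (i \<in> {..<m} \<longrightarrow> t i \<in> {a..b}) \<and> (i \<notin> {..<m} \<longrightarrow> t i = (0::int))}"
    by (rule finite_set_of_finite_funs) auto
qed (auto simp: coords_def)

lemma finite_cube: "finite (cube m k)"
  unfolding cube_def by (rule finite_coords_box)

lemma cube_coords: "t \<in> cube m k \<Longrightarrow> t \<in> coords m"
  by (simp add: cube_def)

lemma finite_row_box: "finite (row_box vs n)"
  unfolding row_box_def by (intro finite_imageI finite_coords_box)

lemma row_boxE:
  assumes "b \<in> row_box vs n"
  obtains c where "c \<in> coords (length vs)" "\<And>i. i < length vs \<Longrightarrow> - int n \<le> c i \<and> c i \<le> int n"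
    "b = comb vs c"
  using assms by (auto simp: row_box_def)

lemma row_boxI:
  assumes "c \<in> coords (length vs)" "\<And>i. i < length vs \<Longrightarrow> - int n \<le> c i \<and> c i \<le> int n"
  shows "comb vs c \<in> row_box vs n"
  using assms by (auto simp: row_box_def)

lemma row_box_add:
  assumes "a \<in> row_box vs m" "b \<in> row_box vs n"
  shows "a + b \<in> row_box vs (m + n)"
proof -
  obtain c d where
    c: "c \<in> coords (length vs)" "\<And>i. i < length vs \<Longrightarrow> - int m \<le> c i \<and> c i \<le> int m" "a = comb vs c" and
    d: "d \<in> coords (length vs)" "\<And>i. i < length vs \<Longrightarrow> - int n \<le> d i \<and> d i \<le> int n" "b = comb vs d"
    using assms by (metis row_boxE)
  have "comb vs (c + d) \<in> row_box vs (m + n)"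
  proof (intro row_boxI coords_add c(1) d(1))
    fix i assume "i < length vs"
    then show "- int (m + n) \<le> (c + d) i \<and> (c + d) i \<le> int (m + n)"
      using c(2)[of i] d(2)[of i] by simp
  qed
  then show ?thesis by (simp add: c(3) d(3) comb_add)
qed

lemma row_box_mono: "m \<le> n \<Longrightarrow> row_box vs m \<subseteq> row_box vs n"
  unfolding row_box_def by (intro image_mono) force

lemma zero_in_row_box [simp]: "0 \<in> row_box vs n"
  using row_boxI[of 0 vs n] by simp

lemma row_box_0: "row_box vs 0 = {0}"
proof -
  have "c = 0" if "c \<in> coords (length vs)" "\<And>i. i < length vs \<Longrightarrow> - int 0 \<le> c i \<and> c i \<le> int 0" for c
  proof
    fix i show "c i = 0 i"
      using that(1) that(2)[of i] by (cases "i < length vs") (auto simp: coords_def)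
  qed
  then show ?thesis by (fastforce elim!: row_boxE)
qed

lemma lattice_basis_row_box:
  assumes "lattice_basis G us" "z \<in> G"
  shows "\<exists>r. z \<in> row_box us r"
proof -
  obtain c where c: "c \<in> coords (length us)" "z = comb us c"
    using assms lattice_basis_eq by blast
  \<comment> \<open>The sum of the absolute values bounds each coordinate and also covers the empty
    basis.\<close>
  define r where "r = (\<Sum>i<length us. nat \<bar>c i\<bar>)"
  have "- int r \<le> c i \<and> c i \<le> int r" if "i < length us" for i
  proof -
    have "nat \<bar>c i\<bar> \<le> r" unfolding r_def
      using that by (intro member_le_sum) auto
    then show ?thesis by linarith
  qed
  then show ?thesis using c row_boxI by blast
qed

locale lattice_split =
  fixes G H :: "(int ^ 'd::finite) set" and us vs :: "(int ^ 'd) list"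
  assumes basis_G: "lattice_basis G us" and basis_H: "lattice_basis H vs"
    and split: "direct_sum G H"
begin

lemma comb_in_G: "i \<in> coords (length us) \<Longrightarrow> comb us i \<in> G"
  using lattice_basis_eq[OF basis_G] by blast

lemma G_add:
  assumes "a \<in> G" "b \<in> G"
  shows "a + b \<in> G"
proof -
  obtain i j where "i \<in> coords (length us)" "j \<in> coords (length us)" "a = comb us i" "b = comb us j"
    using assms lattice_basis_eq[OF basis_G] by blast
  then show ?thesis using comb_in_G[OF coords_add] by (simp flip: comb_add)
qed

lemma stripI: "a \<in> G \<Longrightarrow> b \<in> row_box vs n \<Longrightarrow> a + b \<in> strip G vs n"
  by (auto simp: strip_def)

lemma strip_G_add:
  assumes "a \<in> G" "z \<in> strip G vs n"
  shows "a + z \<in> strip G vs n"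
proof -
  obtain g b where "g \<in> G" "b \<in> row_box vs n" "z = g + b" using assms(2) by (auto simp: strip_def)
  then show ?thesis using stripI[OF G_add[OF assms(1)], of g b n] by (simp add: add.assoc)
qed

lemma strip_add:
  assumes "z \<in> strip G vs m" "z' \<in> strip G vs n"
  shows "z + z' \<in> strip G vs (m + n)"
proof -
  obtain a b a' b' where "z = a + b" "a \<in> G" "b \<in> row_box vs m"
    "z' = a' + b'" "a' \<in> G" "b' \<in> row_box vs n"
    using assms by (auto simp: strip_def)
  moreover have "a + b + (a' + b') = (a + a') + (b + b')" by (simp add: algebra_simps)
  ultimately show ?thesis using stripI[OF G_add row_box_add] by metis
qed

lemma row_box_strip: "b \<in> row_box vs n \<Longrightarrow> b \<in> strip G vs n"
  using stripI[of 0 b n] comb_in_G[of 0] by simp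

lemma strip_mono: "m \<le> n \<Longrightarrow> strip G vs m \<subseteq> strip G vs n"
  using row_box_mono[of m n vs] by (auto simp: strip_def)

text \<open>Each point is split along \<open>G\<close> and \<open>H\<close>, and common bounds are
  taken. Points of \<open>G\<close> have extent 0 along \<open>H\<close>, which is the source of the
  choice \<open>r' = 0\<close>.\<close>

lemma finite_subset_box_plus_box:
  assumes "finite K"
  shows "\<exists>r s. (\<forall>z\<in>K. \<exists>a\<in>row_box us r. \<exists>b\<in>row_box vs s. z = a + b) \<and> (K \<subseteq> G \<longrightarrow> s = 0)"
proof -
  have "\<exists>r s. (\<exists>a\<in>row_box us r. \<exists>b\<in>row_box vs s. z = a + b) \<and> (z \<in> G \<longrightarrow> s = 0)" for z
  proof (cases "z \<in> G")
    case True
    then obtain r where "z \<in> row_box us r" using lattice_basis_row_box[OF basis_G] by blast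
    then show ?thesis using zero_in_row_box[of vs 0] by (metis add.right_neutral)
  next
    case False
    have "z \<in> {g + h |g h. g \<in> G \<and> h \<in> H}" using split by (simp add: direct_sum_def)
    then obtain a b where "a \<in> G" "b \<in> H" "z = a + b" by blast
    then show ?thesis
      using lattice_basis_row_box[OF basis_G] lattice_basis_row_box[OF basis_H] False by metis
  qed
  then obtain r s where rs: "\<And>z. \<exists>a\<in>row_box us (r z). \<exists>b\<in>row_box vs (s z). z = a + b"
    "\<And>z. z \<in> G \<Longrightarrow> s z = 0"
    by metis
  \<comment> \<open>Sums serve as common bounds: they cover empty \<open>K\<close>, and
    \<open>S\<close> vanishes as soon as all its terms do.\<close>
  define R where "R = sum r K"
  define S where "S = sum s K"
  have "\<exists>a\<in>row_box us R. \<exists>b\<in>row_box vs S. z = a + b" if "z \<in> K" for z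
  proof -
    have "r z \<le> R" "s z \<le> S" using that assms by (auto simp: R_def S_def intro: member_le_sum)
    then show ?thesis using rs(1)[of z] row_box_mono by (metis subsetD)
  qed
  moreover have "S = 0" if "K \<subseteq> G" using that rs(2) unfolding S_def by (intro sum.neutral) auto
  ultimately show ?thesis by blast
qed

lemma finite_subset_strip:
  assumes "finite K"
  shows "\<exists>n. K \<subseteq> strip G vs n"
proof -
  obtain r s where K: "\<forall>z\<in>K. \<exists>a\<in>row_box us r. \<exists>b\<in>row_box vs s. z = a + b"
    using finite_subset_box_plus_box[OF assms] by blast
  have "z \<in> strip G vs s" if "z \<in> K" for z
    using K that stripI comb_in_G by (metis row_boxE)
  then show ?thesis by blast
qed

end


section \<open>Adequate row sizes\<close>

text \<open>
  The condition in \<open>speed_row\<close> expressed by values instead of words: all values read off a row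
  approximation in a window of length \<open>k\<close> are also read off some element of the subshift.
\<close>

definition row_covered ::
  "nat \<Rightarrow> (int ^ 'd::finite) set \<Rightarrow> (int ^ 'd) list \<Rightarrow> (int ^ 'd) list
    \<Rightarrow> 'a set \<Rightarrow> (int ^ 'd \<rightharpoonup> 'a) set \<Rightarrow> (int ^ 'd) set \<Rightarrow> ((int ^ 'd \<rightharpoonup> 'a) \<Rightarrow> 'b)
    \<Rightarrow> nat \<Rightarrow> nat \<Rightarrow> bool" where
  "row_covered r G us vs A F U g k n \<longleftrightarrow>
     n \<ge> 1 \<and> (\<forall>i\<in>strip G vs r. \<forall>u\<in>U. i + u \<in> strip G vs n) \<and>
     (\<forall>x\<in>approx_row G vs A F n. \<forall>i\<in>coords (length us).
        \<exists>y\<in>forbid A F. \<exists>j\<in>coords (length us). \<forall>t\<in>cube (length us) k. \<forall>b\<in>row_box vs r.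
          g (window U (Some \<circ> y) (comb us (j + t) + b)) = g (window U x (comb us (i + t) + b)))"

text \<open>In \<open>appears\<close> the position ranges over all functions. If the cube is
  nonempty, an occurrence forces its position into \<open>coords m\<close>; if it is empty, every
  position is an occurrence and 0 will do.\<close>

lemma appears_coords_iff:
  assumes "dom w = cube m k"
  shows "appears w (\<lambda>t. if t \<in> coords m then Some (v t) else None) \<longleftrightarrow>
    (\<exists>i\<in>coords m. \<forall>t\<in>cube m k. w t = Some (v (i + t)))" (is "?L \<longleftrightarrow> ?R")
proof
  assume ?L
  then obtain i where i: "\<forall>t\<in>cube m k. (if i + t \<in> coords m then Some (v (i + t)) else None) = w t"
    by (auto simp: appears_def assms)
  show ?R
  proof (cases "cube m k = {}")
    case True
    then show ?thesis by (intro bexI[of _ 0]) auto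
  next
    case False
    then obtain t where t: "t \<in> cube m k" by blast
    then have "w t \<noteq> None" using assms by auto
    then have "i + t \<in> coords m" using i t by (metis (no_types, lifting))
    then have ic: "i \<in> coords m" using cube_coords[OF t] coords_diff[of "i + t" m t] by simp
    have "w t = Some (v (i + t))" if "t \<in> cube m k" for t
      using i that coords_add[OF ic cube_coords[OF that]] by auto
    then show ?thesis using ic by blast
  qed
next
  assume ?R
  then obtain i where "i \<in> coords m" "\<forall>t\<in>cube m k. w t = Some (v (i + t))" by blast
  then show ?L using coords_add[OF _ cube_coords]
    by (auto simp: appears_def assms intro!: exI[of _ i])
qed

lemma window_Some_eq_iff:
  "window R (\<lambda>p. Some (P p)) a = window R (\<lambda>p. Some (Q p)) a' \<longleftrightarrow> (\<forall>b\<in>R. P (a + b) = Q (a' + b))"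
  by (auto simp: window_def restrict_map_def fun_eq_iff)

lemma local_map_defined: "\<forall>u\<in>U. i + u \<in> dom x \<Longrightarrow> local_map U g x i = Some (g (window U x i))"
  by (simp add: local_map_def)

context lattice_split
begin

lemma SA_local_map:
  assumes "\<forall>i\<in>G. \<forall>u\<in>U. i + u \<in> dom x"
  shows "SA us (local_map U g x) =
    (\<lambda>t. if t \<in> coords (length us) then Some (g (window U x (comb us t))) else None)"
  using local_map_defined[of U _ x g] assms comb_in_G by (auto simp: SA_def fun_eq_iff)

lemma SA_theta_local_map:
  assumes "\<forall>i\<in>strip G vs r. \<forall>u\<in>U. i + u \<in> dom x"
  shows "SA us (theta vs r (local_map U g x)) =
    (\<lambda>t. if t \<in> coords (length us)
      then Some (window (row_box vs r) (\<lambda>p. Some (g (window U x p))) (comb us t)) else None)"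
proof
  fix t
  show "SA us (theta vs r (local_map U g x)) t = (if t \<in> coords (length us)
      then Some (window (row_box vs r) (\<lambda>p. Some (g (window U x p))) (comb us t)) else None)"
  proof (cases "t \<in> coords (length us)")
    case True
    have *: "local_map U g x (comb us t + b) = Some (g (window U x (comb us t + b)))"
      if "b \<in> row_box vs r" for b
      using assms stripI[OF comb_in_G[OF True] that] by (intro local_map_defined) blast
    then have "window (row_box vs r) (local_map U g x) (comb us t) =
        window (row_box vs r) (\<lambda>p. Some (g (window U x p))) (comb us t)"
      by (auto simp: window_def restrict_map_def)
    then show ?thesis using True * by (auto simp: SA_def theta_def local_map_def[of "row_box vs r"])
  qed (simp add: SA_def)
qed

text \<open>The values of \<open>g\<close> read off a row in one window form a word, and
  \<open>gB\<close> puts it over the alphabet of the words considered, so the condition on words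
  applies to it. Conversely, every word of a row is such a reading.\<close>

lemma row_adequate_iff:
  assumes n: "n \<ge> 1" "\<forall>i\<in>strip G vs r. \<forall>u\<in>U. i + u \<in> strip G vs n"
    and gB: "\<And>p. p \<in> maps_on U A \<Longrightarrow> g p \<in> B"
  shows "(\<forall>w\<in>maps_on (cube (length us) k) (maps_on (row_box vs r) B).
      w \<notin> language ((\<lambda>x. SA us (theta vs r (local_map U g (Some \<circ> x)))) ` forbid A F) \<longrightarrow>
      w \<notin> language ((\<lambda>x. SA us (theta vs r (local_map U g x))) ` approx_row G vs A F n))
    \<longleftrightarrow> row_covered r G us vs A F U g k n" (is "?L \<longleftrightarrow> ?R")
proof -
  let ?m = "length us"
  let ?W = "\<lambda>x i. window (row_box vs r) (\<lambda>p. Some (g (window U x p))) (comb us i)"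
  have Sx: "SA us (theta vs r (local_map U g x)) = (\<lambda>t. if t \<in> coords ?m then Some (?W x t) else None)"
    if "x \<in> approx_row G vs A F n" for x
    using that n(2) by (intro SA_theta_local_map) (auto simp: approx_row_def maps_on_def)
  have Sy: "SA us (theta vs r (local_map U g (Some \<circ> y))) = (\<lambda>t. if t \<in> coords ?m then Some (?W (Some \<circ> y) t) else None)"
    for y :: "int ^ 'd \<Rightarrow> 'a"
    by (intro SA_theta_local_map) (auto simp: dom_def)
  have Lx: "w \<in> language ((\<lambda>x. SA us (theta vs r (local_map U g x))) ` approx_row G vs A F n) \<longleftrightarrow>
      (\<exists>x\<in>approx_row G vs A F n. \<exists>i\<in>coords ?m. \<forall>t\<in>cube ?m k. w t = Some (?W x (i + t)))"
    if "dom w = cube ?m k" for w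
    using appears_coords_iff[OF that] that by (simp add: language_def Sx finite_cube)
  have Ly: "w \<in> language ((\<lambda>x. SA us (theta vs r (local_map U g (Some \<circ> x)))) ` forbid A F) \<longleftrightarrow>
      (\<exists>y\<in>forbid A F. \<exists>j\<in>coords ?m. \<forall>t\<in>cube ?m k. w t = Some (?W (Some \<circ> y) (j + t)))"
    if "dom w = cube ?m k" for w
    using appears_coords_iff[OF that] that by (simp add: language_def Sy finite_cube)
  show ?thesis
  proof
    assume L: ?L
    have "\<exists>y\<in>forbid A F. \<exists>j\<in>coords ?m. \<forall>t\<in>cube ?m k. \<forall>b\<in>row_box vs r.
        g (window U (Some \<circ> y) (comb us (j + t) + b)) = g (window U x (comb us (i + t) + b))"
      if x: "x \<in> approx_row G vs A F n" and i: "i \<in> coords ?m" for x i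
    proof -
      define w where "w t = (if t \<in> cube ?m k then Some (?W x (i + t)) else None)" for t
      have dw: "dom w = cube ?m k" by (auto simp: w_def dom_def)
      have "?W x (i + t) \<in> maps_on (row_box vs r) B" if t: "t \<in> cube ?m k" for t
      proof -
        \<comment> \<open>The domain condition keeps this translate of \<open>U\<close> inside the
          strip, so the window is a complete pattern over \<open>A\<close> and \<open>gB\<close>
          applies to it.\<close>
        have "window U x (comb us (i + t) + b) \<in> maps_on U A" if "b \<in> row_box vs r" for b
        proof -
          have "comb us (i + t) + b \<in> strip G vs r"
            using stripI[OF comb_in_G[OF coords_add[OF i cube_coords[OF t]]] that] .
          then have "\<forall>u\<in>U. comb us (i + t) + b + u \<in> dom x"
            using n(2) x by (auto simp: approx_row_def maps_on_def)
          then show ?thesis using x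
            by (auto simp: window_def maps_on_def approx_row_def restrict_map_def dom_def ran_def
                split: if_splits)
        qed
        then show ?thesis using gB
          by (auto simp: window_def[of "row_box vs r"] maps_on_def[of "row_box vs r"]
              restrict_map_def dom_def ran_def split: if_splits)
      qed
      then have "w \<in> maps_on (cube ?m k) (maps_on (row_box vs r) B)"
        using dw by (auto simp: maps_on_def[of "cube ?m k"] ran_def w_def split: if_splits)
      moreover have "w \<in> language ((\<lambda>x. SA us (theta vs r (local_map U g x))) ` approx_row G vs A F n)"
        unfolding Lx[OF dw] using x i by (auto simp: w_def)
      ultimately obtain y j where "y \<in> forbid A F" "j \<in> coords ?m"
        "\<forall>t\<in>cube ?m k. w t = Some (?W (Some \<circ> y) (j + t))"
        using L Ly[OF dw] by blast
      then show ?thesis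
        by (intro bexI[of _ y] bexI[of _ j]) (auto simp: w_def window_Some_eq_iff)
    qed
    then show ?R using n by (simp add: row_covered_def)
  next
    assume R: ?R
    show ?L
    proof (intro ballI impI notI)
      fix w assume w: "w \<in> maps_on (cube ?m k) (maps_on (row_box vs r) B)"
        and ny: "w \<notin> language ((\<lambda>x. SA us (theta vs r (local_map U g (Some \<circ> x)))) ` forbid A F)"
        and wx: "w \<in> language ((\<lambda>x. SA us (theta vs r (local_map U g x))) ` approx_row G vs A F n)"
      have dw: "dom w = cube ?m k" using w by (simp add: maps_on_def)
      obtain x i where x: "x \<in> approx_row G vs A F n" "i \<in> coords ?m"
        "\<forall>t\<in>cube ?m k. w t = Some (?W x (i + t))"
        using wx Lx[OF dw] by blast
      then obtain y j where y: "y \<in> forbid A F" "j \<in> coords ?m"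
        "\<forall>t\<in>cube ?m k. ?W (Some \<circ> y) (j + t) = ?W x (i + t)"
        using R unfolding row_covered_def window_Some_eq_iff by blast
      then have "\<forall>t\<in>cube ?m k. w t = Some (?W (Some \<circ> y) (j + t))" using x(3) by simp
      then show False using ny y(1,2) unfolding Ly[OF dw] by blast
    qed
  qed
qed

lemma speed_row_eq:
  assumes "\<And>p. p \<in> maps_on U A \<Longrightarrow> g p \<in> B"
  shows "speed_row r G us vs A F B U g k = (LEAST n. row_covered r G us vs A F U g k n)"
  unfolding speed_row_def speed_on_def
proof (rule arg_cong[where f = Least], rule ext)
  fix n
  show "(n \<ge> 1 \<and> (\<forall>i\<in>strip G vs r. \<forall>u\<in>U. i + u \<in> strip G vs n) \<and>
      (\<forall>w\<in>maps_on (cube (length us) k) (maps_on (row_box vs r) B).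
        w \<notin> language ((\<lambda>x. SA us (theta vs r (local_map U g (Some \<circ> x)))) ` forbid A F) \<longrightarrow>
        w \<notin> language ((\<lambda>x. SA us (theta vs r (local_map U g x))) ` approx_row G vs A F n))) =
    row_covered r G us vs A F U g k n"
  proof (cases "n \<ge> 1 \<and> (\<forall>i\<in>strip G vs r. \<forall>u\<in>U. i + u \<in> strip G vs n)")
    case True
    then show ?thesis using row_adequate_iff[of n r U A g B k F] assms by blast
  next
    case False
    then show ?thesis unfolding row_covered_def by blast
  qed
qed

text \<open>The words in \<open>speed\<close> have letters where those in \<open>speed_row 0\<close>
  have patterns on \<open>{0}\<close>. An upper bound suffices, since \<open>speed\<close> stands at
  the left end of the chain of inequalities.\<close>

lemma speed_le:
  assumes "row_covered 0 G us vs A F U g k n"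
  shows "speed G us vs A F B U g k \<le> n"
  unfolding speed_def speed_on_def
proof (rule Least_le, intro conjI ballI impI notI)
  let ?m = "length us"
  have s0: "strip G vs 0 = G" by (auto simp: strip_def row_box_0)
  show "1 \<le> n" using assms by (simp add: row_covered_def)
  show U: "i + u \<in> strip G vs n" if "i \<in> G" "u \<in> U" for i u
    using that assms by (simp add: row_covered_def s0)
  fix w assume w: "w \<in> maps_on (cube ?m k) B"
    and ny: "w \<notin> language ((\<lambda>x. SA us (local_map U g (Some \<circ> x))) ` forbid A F)"
    and wx: "w \<in> language ((\<lambda>x. SA us (local_map U g x)) ` approx_row G vs A F n)"
  have dw: "dom w = cube ?m k" using w by (simp add: maps_on_def)
  have Sx: "SA us (local_map U g x) =
      (\<lambda>t. if t \<in> coords ?m then Some (g (window U x (comb us t))) else None)"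
    if "x \<in> approx_row G vs A F n" for x
    using that U by (intro SA_local_map) (auto simp: approx_row_def maps_on_def)
  have Sy: "SA us (local_map U g (Some \<circ> y)) =
      (\<lambda>t. if t \<in> coords ?m then Some (g (window U (Some \<circ> y) (comb us t))) else None)"
    for y :: "int ^ 'd \<Rightarrow> 'a"
    by (intro SA_local_map) (auto simp: dom_def)
  obtain x i where x: "x \<in> approx_row G vs A F n" "i \<in> coords ?m"
      "\<forall>t\<in>cube ?m k. w t = Some (g (window U x (comb us (i + t))))"
    using wx by (auto simp: language_def Sx appears_coords_iff[OF dw])
  then obtain y j where "y \<in> forbid A F" "j \<in> coords ?m"
      "\<forall>t\<in>cube ?m k. g (window U (Some \<circ> y) (comb us (j + t))) = g (window U x (comb us (i + t)))"
    using assms unfolding row_covered_def row_box_0 by fastforce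
  then have "w \<in> language ((\<lambda>x. SA us (local_map U g (Some \<circ> x))) ` forbid A F)"
    using x(3) by (auto simp: language_def Sy appears_coords_iff[OF dw] dw finite_cube intro!: bexI)
  then show False using ny by simp
qed

text \<open>The central comparison. Since \<open>h\<close> computes \<open>g'\<close> from the
  values of \<open>g\<close> on a translate of \<open>K\<close>, what \<open>g'\<close> shows in a
  window is determined by what \<open>g\<close> shows in a window longer by \<open>r\<close> at both
  ends in each direction of \<open>G\<close>, with a row larger by \<open>q\<close>. A match for
  \<open>g\<close> is therefore a match for \<open>g'\<close>.\<close>

lemma row_covered_factor:
  assumes cov: "row_covered (s + q) G us vs A F U g (k + 2 * r) n"
    and K: "\<And>z. z \<in> K \<Longrightarrow> \<exists>a\<in>row_box us r. \<exists>b\<in>row_box vs q. z = a + b"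
    and row: "\<And>x p. x \<in> approx_row G vs A F n \<Longrightarrow> \<forall>u\<in>U. p + u \<in> strip G vs n \<Longrightarrow>
      g' (window U x p) = h (window K (\<lambda>p. Some (g (window U x p))) p)"
    and full: "\<And>y p. y \<in> forbid A F \<Longrightarrow>
      g' (window U (Some \<circ> y) p) = h (window K (\<lambda>p. Some (g (window U (Some \<circ> y) p))) p)"
  shows "row_covered s G us vs A F U g' k n"
  unfolding row_covered_def
proof (intro conjI ballI)
  let ?m = "length us"
  show "1 \<le> n" using cov by (simp add: row_covered_def)
  show U: "i + u \<in> strip G vs n" if "i \<in> strip G vs s" "u \<in> U" for i u
    using that cov strip_mono[of s "s + q"] by (auto simp: row_covered_def)
  fix x i assume x: "x \<in> approx_row G vs A F n" and i: "i \<in> coords ?m"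
  \<comment> \<open>The vector with all coordinates \<open>r\<close>: the longer window starts at
    \<open>i - e\<close>, so that the shorter one sits in its middle.\<close>
  define e :: "nat \<Rightarrow> int" where "e l = (if l < ?m then int r else 0)" for l
  have e: "e \<in> coords ?m" by (auto simp: coords_def e_def)
  obtain y j where y: "y \<in> forbid A F" "j \<in> coords ?m" and
    eq: "\<And>t b. t \<in> cube ?m (k + 2 * r) \<Longrightarrow> b \<in> row_box vs (s + q) \<Longrightarrow>
      g (window U (Some \<circ> y) (comb us (j + t) + b)) = g (window U x (comb us (i - e + t) + b))"
  proof -
    have "\<exists>y\<in>forbid A F. \<exists>j\<in>coords ?m. \<forall>t\<in>cube ?m (k + 2 * r). \<forall>b\<in>row_box vs (s + q).
        g (window U (Some \<circ> y) (comb us (j + t) + b)) = g (window U x (comb us (i - e + t) + b))"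
      using cov x coords_diff[OF i e] by (simp add: row_covered_def)
    then show ?thesis using that by blast
  qed
  show "\<exists>y\<in>forbid A F. \<exists>j\<in>coords ?m. \<forall>t\<in>cube ?m k. \<forall>b\<in>row_box vs s.
      g' (window U (Some \<circ> y) (comb us (j + t) + b)) = g' (window U x (comb us (i + t) + b))"
  proof (intro bexI ballI)
    \<comment> \<open>The match of the longer window starts at \<open>j\<close>, hence that of the
      shorter one at \<open>j + e\<close>.\<close>
    show "y \<in> forbid A F" "j + e \<in> coords ?m" using y e by auto
    fix t b assume t: "t \<in> cube ?m k" and b: "b \<in> row_box vs s"
    have tc: "t \<in> coords ?m" using cube_coords[OF t] .
    have "g (window U (Some \<circ> y) (comb us (j + e + t) + b + z)) = g (window U x (comb us (i + t) + b + z))"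
      if z: "z \<in> K" for z
    proof -
      obtain a d where ad: "a \<in> row_box us r" "d \<in> row_box vs q" "z = a + d" using K[OF z] by blast
      obtain c where c: "c \<in> coords ?m" "\<And>i. i < ?m \<Longrightarrow> - int r \<le> c i \<and> c i \<le> int r" "a = comb us c"
        by (rule row_boxE[OF ad(1)]) (rule that, assumption+)
      \<comment> \<open>In each coordinate \<open>t\<close> lies in \<open>[0, k - 1]\<close> and
        \<open>c\<close> in \<open>[- r, r]\<close>; adding \<open>r\<close> gives the range
        \<open>[0, k + 2 * r - 1]\<close>.\<close>
      have "e + t + c \<in> cube ?m (k + 2 * r)"
      proof -
        have "0 \<le> (e + t + c) l \<and> (e + t + c) l \<le> int (k + 2 * r) - 1" if "l < ?m" for l
          using c(2)[OF that] t that by (auto simp: cube_def e_def)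
        then show ?thesis using e tc c(1) by (auto simp: cube_def)
      qed
      moreover have "comb us (j + (e + t + c)) + (b + d) = comb us (j + e + t) + b + z"
        "comb us (i - e + (e + t + c)) + (b + d) = comb us (i + t) + b + z"
        using comb_add[of us "i - e" e] by (simp_all add: ad(3) c(3) comb_add algebra_simps)
      ultimately show ?thesis using eq[OF _ row_box_add[OF b ad(2)]] by metis
    qed
    then have "window K (\<lambda>p. Some (g (window U (Some \<circ> y) p))) (comb us (j + e + t) + b) =
        window K (\<lambda>p. Some (g (window U x p))) (comb us (i + t) + b)"
      by (simp add: window_Some_eq_iff)
    moreover have "\<forall>u\<in>U. comb us (i + t) + b + u \<in> strip G vs n"
      using U stripI[OF comb_in_G[OF coords_add[OF i tc]] b] by blast
    ultimately show "g' (window U (Some \<circ> y) (comb us (j + e + t) + b)) = g' (window U x (comb us (i + t) + b))"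
      using row[OF x] full[OF y(1)] by simp
  qed
qed

end

text \<open>
  The configurations that satisfy the constraints inside the strip of size \<open>n\<close> and show at the
  origin a window not occurring in the subshift form a decreasing sequence of closed sets with
  empty intersection.
\<close>

lemma (in lattice_split) row_covered_exists:
  assumes A: "finite A" "finite_patterns A F" and U: "finite U"
  shows "\<exists>n. row_covered r G us vs A F U g k n"
proof -
  let ?m = "length us"
  obtain a where a: "U \<subseteq> strip G vs a" using finite_subset_strip[OF U] by blast
  \<comment> \<open>The values that \<open>x\<close> shows in the window at the origin also occur in
    the subshift; \<open>W\<close> collects the finitely many coordinates on which this
    depends.\<close>
  define good where "good x \<longleftrightarrow> (\<exists>y\<in>forbid A F. \<exists>j\<in>coords ?m. \<forall>t\<in>cube ?m k. \<forall>b\<in>row_box vs r.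
      g (window U (Some \<circ> y) (comb us (j + t) + b)) = g (window U (Some \<circ> x) (comb us t + b)))" for x
  define W where "W = (\<lambda>(t, b, u). comb us t + b + u) ` (cube ?m k \<times> row_box vs r \<times> U)"
  have "finite W" unfolding W_def by (intro finite_imageI finite_cartesian_product U finite_cube finite_row_box)
  have good_cong: "good x \<longleftrightarrow> good x'" if "\<forall>z\<in>W. x z = x' z" for x x'
  proof -
    have "window U (Some \<circ> x) (comb us t + b) = window U (Some \<circ> x') (comb us t + b)"
      if tb: "t \<in> cube ?m k" "b \<in> row_box vs r" for t b
    proof -
      have "x (comb us t + b + u) = x' (comb us t + b + u)" if "u \<in> U" for u
        using \<open>\<forall>z\<in>W. x z = x' z\<close> tb that by (force simp: W_def)
      then show ?thesis by (auto simp: window_def restrict_map_def)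
    qed
    then show ?thesis by (simp add: good_def)
  qed
  define C1 where "C1 n = {x \<in> full_shift A. \<forall>p\<in>F. \<forall>i.
      (\<forall>u\<in>dom p. i + u \<in> strip G vs n) \<longrightarrow> (\<exists>u\<in>dom p. Some (x (i + u)) \<noteq> p u)}" for n
  define C2 where "C2 = {x \<in> full_shift A. \<not> good x}"
  have C2: "closedin (configs_top A) C2"
  proof (rule closedin_configs_topI)
    fix x assume x: "x \<in> full_shift A" "x \<notin> C2"
    have "y \<notin> C2" if "\<forall>u\<in>W. y u = x u" for y
      using good_cong[OF that] x by (simp add: C2_def)
    then show "\<exists>V. finite V \<and> (\<forall>y\<in>full_shift A. (\<forall>u\<in>V. y u = x u) \<longrightarrow> y \<notin> C2)"
      using \<open>finite W\<close> by blast
  qed (auto simp: C2_def)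
  have clo: "closedin (configs_top A) (C1 n \<inter> C2)" for n
    using A(2) unfolding C1_def
    by (intro closedin_Int[OF _ C2] closedin_avoiding) (auto simp: finite_patterns_def)
  have dec: "decseq (\<lambda>n. C1 n \<inter> C2)"
  proof (rule decseq_SucI)
    fix n
    have "strip G vs n \<subseteq> strip G vs (Suc n)" by (rule strip_mono) simp
    then show "C1 (Suc n) \<inter> C2 \<subseteq> C1 n \<inter> C2" unfolding C1_def by blast
  qed
  have "(\<Inter>n. C1 n \<inter> C2) = {}"
  proof (rule ccontr)
    assume "(\<Inter>n. C1 n \<inter> C2) \<noteq> {}"
    then obtain x where x: "\<And>n. x \<in> C1 n" "x \<in> C2" by blast
    \<comment> \<open>The support of an occurrence is finite and so lies in some strip. Hence a
      point of all \<open>C1 n\<close> belongs to the subshift, and is then itself a witness that it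
      is \<open>good\<close>.\<close>
    have "\<not> appears p (Some \<circ> x)" if "p \<in> F" for p
    proof
      assume "appears p (Some \<circ> x)"
      then obtain i where i: "\<forall>u\<in>dom p. Some (x (i + u)) = p u" by (auto simp: appears_def)
      have "finite ((+) i ` dom p)" using that A(2) by (simp add: finite_patterns_def)
      then obtain n where "(+) i ` dom p \<subseteq> strip G vs n" using finite_subset_strip by blast
      then show False using x(1)[of n] i that by (fastforce simp: C1_def)
    qed
    then have "x \<in> forbid A F" using x(2) by (simp add: forbid_def C2_def)
    then have "good x" unfolding good_def by (intro bexI[of _ x] bexI[of _ 0]) auto
    then show False using x(2) by (simp add: C2_def)
  qed
  then obtain n0 where n0: "C1 n0 \<inter> C2 = {}"
    using compact_space_imp_nest[OF compact_space_configs_top[OF A(1)] clo _ dec] by blast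
  \<comment> \<open>The bounds \<open>1\<close> and \<open>r + a\<close> provide
    \<open>n \<ge> 1\<close> and the domain condition; enlarging \<open>n0\<close> is harmless
    because the sets decrease.\<close>
  define n where "n = max n0 (max 1 (r + a))"
  have n: "C1 n \<inter> C2 = {}"
    using decseqD[OF dec, of n0 n] n0 by (auto simp: n_def)
  have dU: "i + u \<in> strip G vs n" if "i \<in> strip G vs r" "u \<in> U" for i u
  proof -
    have "i + u \<in> strip G vs (r + a)" using strip_add[OF that(1)] that(2) a by blast
    moreover have "r + a \<le> n" by (simp add: n_def)
    ultimately show ?thesis using strip_mono by blast
  qed
  have "row_covered r G us vs A F U g k n"
    unfolding row_covered_def
  proof (intro conjI ballI)
    fix x i assume x: "x \<in> approx_row G vs A F n" and i: "i \<in> coords ?m"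
    have dx: "dom x = strip G vs n" and rx: "ran x \<subseteq> A" and Fx: "\<And>p. p \<in> F \<Longrightarrow> \<not> appears p x"
      using x by (auto simp: approx_row_def maps_on_def)
    \<comment> \<open>The row is nonempty, so \<open>A\<close> contains a symbol with which to fill
      the complement of the strip.\<close>
    have "0 \<in> dom x" using dx row_box_strip[of 0 n] by simp
    then obtain a0 where a0: "a0 \<in> A" using rx by (auto simp: ran_def)
    \<comment> \<open>The row, translated so that position \<open>comb us i\<close> becomes the
      origin and filled with \<open>a0\<close> elsewhere. The strip is invariant under
      \<open>G\<close>, and \<open>C1 n\<close> does not see the filling.\<close>
    define z where "z l = (case x (comb us i + l) of Some c \<Rightarrow> c | None \<Rightarrow> a0)" for l
    have zx: "x (comb us i + l) = Some (z l)" if "l \<in> strip G vs n" for l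
      using strip_G_add[OF comb_in_G[OF i] that] unfolding dx[symmetric] by (auto simp: z_def)
    have zA: "z \<in> full_shift A"
      using a0 rx by (fastforce simp: full_shift_def z_def ran_def split: option.split)
    have "z \<in> C1 n" unfolding C1_def
    proof (intro CollectI conjI zA ballI allI impI)
      fix p l assume p: "p \<in> F" "\<forall>u\<in>dom p. l + u \<in> strip G vs n"
      show "\<exists>u\<in>dom p. Some (z (l + u)) \<noteq> p u"
      proof (rule ccontr)
        assume "\<not> ?thesis"
        then have "\<forall>u\<in>dom p. x (comb us i + l + u) = p u"
          using p(2) zx by (simp add: add.assoc)
        then show False using Fx[OF p(1)] unfolding appears_def by blast
      qed
    qed
    then have "good z" using n zA by (auto simp: C2_def)
    moreover have "window U (Some \<circ> z) (comb us t + b) = window U x (comb us (i + t) + b)"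
      if t: "t \<in> cube ?m k" and b: "b \<in> row_box vs r" for t b
    proof -
      have "x (comb us i + (comb us t + b + u)) = Some (z (comb us t + b + u))" if "u \<in> U" for u
        using dU[OF stripI[OF comb_in_G[OF cube_coords[OF t]] b] that] by (rule zx)
      then show ?thesis
        by (auto simp: window_def restrict_map_def comb_add add.assoc)
    qed
    ultimately show "\<exists>y\<in>forbid A F. \<exists>j\<in>coords ?m. \<forall>t\<in>cube ?m k. \<forall>b\<in>row_box vs r.
        g (window U (Some \<circ> y) (comb us (j + t) + b)) = g (window U x (comb us (i + t) + b))"
      unfolding good_def by simp
  qed (use dU in \<open>auto simp: n_def\<close>)
  then show ?thesis by blast
qed


section \<open>The common cover\<close>

lemma window_in_maps_on:
  assumes "x \<in> maps_on D A" "\<And>u. u \<in> U \<Longrightarrow> i + u \<in> D"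
  shows "window U x i \<in> maps_on U A"
  using assms by (auto simp: window_def maps_on_def restrict_map_def dom_def ran_def split: if_splits)

lemma full_shift_maps_on: "x \<in> full_shift A \<Longrightarrow> Some \<circ> x \<in> maps_on UNIV A"
  by (auto simp: full_shift_def maps_on_def ran_def)

lemma window_window:
  fixes i j :: "'i::semigroup_add"
  assumes "\<And>v. v \<in> V \<Longrightarrow> j + v \<in> U"
  shows "window V (window U x i) j = window V x (i + j)"
  using assms by (auto simp: window_def restrict_map_def add.assoc)

lemma full_shift_empty: "full_shift {} = {}"
  by (auto simp: full_shift_def)

text \<open>Compactness gives no control over where the neighborhood lies, so one inside
  \<open>G\<close> is taken whenever it exists.\<close>

lemma conjugacy_local_rule_within:
  assumes "subshift A X" "conjugacy A X B Y f"
  shows "\<exists>N q. has_local_rule X f N q \<and> ((\<exists>N\<subseteq>G. neighborhood X f N) \<longrightarrow> N \<subseteq> G)"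
proof (cases "\<exists>N\<subseteq>G. neighborhood X f N")
  case True
  then show ?thesis unfolding neighborhood_def by blast
next
  case False
  then show ?thesis
    using morphism_has_local_rule[of A X B Y f] assms
    unfolding subshift_def conjugacy_def by blast
qed

text \<open>Factor maps live on the whole full shift, and there is none from a nonempty full shift
  into an empty one. For empty \<open>T\<close>, where \<open>B\<close> may be empty, the empty
  alphabet is therefore chosen.\<close>

lemma sofic_cover:
  assumes "sofic B T"
  shows "\<exists>(A :: nat set) F f. finite A \<and> finite_patterns A F \<and> morphism A (forbid A F) B T f \<and>
    f ` forbid A F = T \<and> (T = {} \<longrightarrow> A = {})"
proof (cases "T = {}")
  case True
  have "morphism {} (forbid {} {}) B {} (\<lambda>_ _. undefined)"
    by (auto simp: morphism_def forbid_def full_shift_empty continuous_map_def)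
  then show ?thesis
    by (intro exI[of _ "{}"] exI[of _ "\<lambda>_ _. undefined"])
      (auto simp: True finite_patterns_def forbid_def full_shift_empty)
next
  case False
  then show ?thesis using assms unfolding sofic_def by blast
qed

theorem corollary2p3:
  fixes G H :: "(int ^ 'd::finite) set"
    and us vs :: "(int ^ 'd) list"
    and B :: "'b set" and B' :: "'c set"
    and T :: "(int ^ 'd \<Rightarrow> 'b) set" and T' :: "(int ^ 'd \<Rightarrow> 'c) set"
    and \<psi> :: "(int ^ 'd \<Rightarrow> 'b) \<Rightarrow> (int ^ 'd \<Rightarrow> 'c)"
  assumes "lattice_basis G us" and "lattice_basis H vs" and "direct_sum G H"
    and "finite B" and "finite B'"
    and "sofic B T" and "sofic B' T'"
    and "conjugacy B T B' T' \<psi>"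
  shows "\<exists>(A :: nat set) F \<pi> U g \<pi>' U' g' r r'.
    finite A \<and> finite_patterns A F \<and>
    factor_map A (forbid A F) B T \<pi> \<and> has_local_rule (full_shift A) \<pi> U g \<and>
    factor_map A (forbid A F) B' T' \<pi>' \<and> has_local_rule (full_shift A) \<pi>' U' g' \<and>
    (\<forall>k. speed G us vs A F B U g k \<le> speed_row r' G us vs A F B' U' g' (k + 2 * r) \<and>
         speed_row r' G us vs A F B' U' g' (k + 2 * r)
           \<le> speed_row (2 * r') G us vs A F B U g (k + 4 * r)) \<and>
    ((\<exists>N\<subseteq>G. neighborhood T \<psi> N) \<and> (\<exists>N\<subseteq>G. neighborhood T' (inv_into T \<psi>) N)
       \<longrightarrow> r' = 0)"
proof -
  interpret lattice_split G H us vs using assms(1-3) by unfold_locales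
  have sub: "subshift B T" "subshift B' T'" using assms(6,7) by (auto simp: sofic_def)
  have TB: "T \<subseteq> full_shift B" "T' \<subseteq> full_shift B'"
    using sub closedin_subset by (auto simp: subshift_def) fastforce+
  have bij: "bij_betw \<psi> T T'" using assms(8) by (simp add: conjugacy_def)
  then have inj: "inj_on \<psi> T" and img: "\<psi> ` T = T'" by (auto simp: bij_betw_def)

  \<comment> \<open>Local rules of the cover, the conjugacy and its inverse\<close>
  obtain A :: "nat set" and F0 f where A: "finite A" "finite_patterns A F0"
    "morphism A (forbid A F0) B T f" "f ` forbid A F0 = T" "T = {} \<longrightarrow> A = {}"
    using sofic_cover[OF assms(6)] by blast
  obtain V h where "has_local_rule (forbid A F0) f V h"
    using morphism_has_local_rule[OF A(1) closedin_forbid[OF A(2)] shift_in_forbid A(3)] by blast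
  then have V: "finite V" "\<And>y i. y \<in> forbid A F0 \<Longrightarrow> f y i = h (window V (Some \<circ> y) i)"
    by (auto simp: has_local_rule_def)
  obtain N q where "has_local_rule T \<psi> N q"
    and NG: "(\<exists>N\<subseteq>G. neighborhood T \<psi> N) \<longrightarrow> N \<subseteq> G"
    using conjugacy_local_rule_within[OF sub(1) assms(8), of G] by blast
  then have N: "finite N" "\<And>x i. x \<in> T \<Longrightarrow> \<psi> x i = q (window N (Some \<circ> x) i)"
    by (auto simp: has_local_rule_def)
  obtain M s where "has_local_rule T' (inv_into T \<psi>) M s"
    and MG: "(\<exists>N\<subseteq>G. neighborhood T' (inv_into T \<psi>) N) \<longrightarrow> M \<subseteq> G"
    using conjugacy_local_rule_within[OF sub(2) conjugacy_inverse[OF sub assms(8)], of G] by blast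
  then have M: "finite M" "\<And>x i. x \<in> T' \<Longrightarrow> inv_into T \<psi> x i = s (window M (Some \<circ> x) i)"
    by (auto simp: has_local_rule_def)
  \<comment> \<open>A common pair of extents for both neighborhoods, so that passing in either
    direction costs the same.\<close>
  obtain r r' where rr: "\<And>z. z \<in> N \<union> M \<Longrightarrow> \<exists>a\<in>row_box us r. \<exists>b\<in>row_box vs r'. z = a + b"
    and r'0: "N \<union> M \<subseteq> G \<longrightarrow> r' = 0"
    using finite_subset_box_plus_box[OF finite_UnI[OF N(1) M(1)]] by blast

  \<comment> \<open>A local rule is only controlled on patterns that occur, so its other values are moved into the alphabet.\<close>
  define into :: "'b \<Rightarrow> 'b" where "into b = (if b \<in> B then b else SOME b. b \<in> B)" for b
  define into' :: "'c \<Rightarrow> 'c" where "into' c = (if c \<in> B' then c else SOME c. c \<in> B')" for c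
  \<comment> \<open>\<open>P\<close> is the cover, \<open>P'\<close> the conjugacy applied to it,
    and \<open>Q\<close> the inverse applied to \<open>P'\<close>. They take partial maps, so the
    same formulas apply to configurations, rows and patterns.\<close>
  define P where "P x i = into (h (window V x i))" for x i
  define P' where "P' x i = into' (q (window N (\<lambda>j. Some (P x j)) i))" for x i
  define Q where "Q x i = s (window M (\<lambda>j. Some (P' x j)) i)" for x i
  \<comment> \<open>Using one large neighborhood for both maps makes the comparison of the domain conditions trivial. It contains \<open>0\<close> so that no pattern on it exists over an empty alphabet.\<close>
  define U where "U = insert 0 (V \<union> (\<lambda>(n, v). n + v) ` (N \<times> V) \<union>
      (\<lambda>(m, n, v). m + n + v) ` (M \<times> N \<times> V))"
  have "finite U" using V(1) N(1) M(1) by (simp add: U_def)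
  have UV: "v \<in> V \<Longrightarrow> v \<in> U" "n \<in> N \<Longrightarrow> v \<in> V \<Longrightarrow> n + v \<in> U"
    "m \<in> M \<Longrightarrow> n \<in> N \<Longrightarrow> v \<in> V \<Longrightarrow> m + n + v \<in> U" for m n v
    by (force simp: U_def)+
  \<comment> \<open>A pattern on \<open>U\<close> determines \<open>P\<close> and \<open>Q\<close>
    at the origin; it is forbidden if the reconstruction \<open>Q\<close> fails there.\<close>
  define F where "F = F0 \<union> {p \<in> maps_on U A. P p 0 \<noteq> Q p 0}"
  define g where "g p = P p 0" for p
  define g' where "g' p = P' p 0" for p

  \<comment> \<open>Evaluation on windows\<close>
  have Pw: "P (window U x i) j = P x (i + j)" if "\<And>v. v \<in> V \<Longrightarrow> j + v \<in> U" for x i j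
    using window_window[of V j U x i] that by (simp add: P_def)
  have P'w: "P' (window U x i) j = P' x (i + j)" if "\<And>n v. n \<in> N \<Longrightarrow> v \<in> V \<Longrightarrow> j + n + v \<in> U" for x i j
  proof -
    have "P (window U x i) (j + n) = P x (i + j + n)" if n: "n \<in> N" for n
      using Pw[of "j + n"] that \<open>\<And>n v. n \<in> N \<Longrightarrow> v \<in> V \<Longrightarrow> j + n + v \<in> U\<close> by (simp add: add.assoc)
    then have "window N (\<lambda>l. Some (P (window U x i) l)) j = window N (\<lambda>l. Some (P x l)) (i + j)"
      by (simp add: window_Some_eq_iff)
    then show ?thesis by (simp add: P'_def)
  qed
  have Qw: "Q (window U x i) 0 = Q x i" for x i
  proof -
    have "P' (window U x i) (0 + m) = P' x (i + m)" if m: "m \<in> M" for m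
      using P'w[of m] UV(3)[OF m] by simp
    then have "window M (\<lambda>l. Some (P' (window U x i) l)) 0 = window M (\<lambda>l. Some (P' x l)) i"
      by (simp only: window_Some_eq_iff) blast
    then show ?thesis by (simp add: Q_def)
  qed
  have gw: "g (window U x i) = P x i" and g'w: "g' (window U x i) = P' x i" for x i
    using Pw[of 0 x i] P'w[of 0 x i] UV by (auto simp: g_def g'_def)

  \<comment> \<open>This ensures that the default symbols in \<open>into\<close> and
    \<open>into'\<close> really belong to the alphabets.\<close>
  have ABne: "B \<noteq> {}" "B' \<noteq> {}" if "A \<noteq> {}"
  proof -
    have "T \<noteq> {}" "T' \<noteq> {}" using that A(5) img by auto
    then show "B \<noteq> {}" "B' \<noteq> {}" using TB by (auto simp: full_shift_empty)
  qed
  have gB: "g p \<in> B" and g'B: "g' p \<in> B'" if "p \<in> maps_on U A" for p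
  proof -
    have "p 0 \<noteq> None" using that by (auto simp: maps_on_def U_def dom_def)
    then have "A \<noteq> {}" using that by (auto simp: maps_on_def ran_def)
    then show "g p \<in> B" "g' p \<in> B'" using ABne some_in_eq[of B] some_in_eq[of B']
      by (auto simp: g_def g'_def P_def P'_def into_def into'_def)
  qed

  \<comment> \<open>Agreement with the cover and the conjugacy on the subshift\<close>
  have fP: "P (Some \<circ> y) = f y" "P' (Some \<circ> y) = \<psi> (f y)" "Q (Some \<circ> y) = f y"
    if y: "y \<in> forbid A F0" for y
  proof -
    have fT: "f y \<in> T" and \<psi>T: "\<psi> (f y) \<in> T'" using A(4) y img by auto
    show *: "P (Some \<circ> y) = f y"
    proof
      fix i
      have "f y i \<in> B" using fT TB(1) by (auto simp: full_shift_def)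
      then show "P (Some \<circ> y) i = f y i" using V(2)[OF y] by (simp add: P_def into_def)
    qed
    show **: "P' (Some \<circ> y) = \<psi> (f y)"
    proof
      fix i
      have "\<psi> (f y) i \<in> B'" using \<psi>T TB(2) by (auto simp: full_shift_def)
      then show "P' (Some \<circ> y) i = \<psi> (f y) i"
        using N(2)[OF fT, of i] by (simp add: P'_def into'_def * comp_def[of Some "f y"])
    qed
    show "Q (Some \<circ> y) = f y"
    proof
      fix i
      have "Q (Some \<circ> y) i = inv_into T \<psi> (\<psi> (f y)) i"
        using M(2)[OF \<psi>T, of i] by (simp add: Q_def ** comp_def[of Some "\<psi> (f y)"])
      then show "Q (Some \<circ> y) i = f y i" using inj fT by simp
    qed
  qed
  \<comment> \<open>On the original subshift the inverse undoes the conjugacy, so \<open>P\<close>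
    and \<open>Q\<close> agree and none of the added patterns occurs.\<close>
  have forbid_eq: "forbid A F = forbid A F0"
  proof
    show "forbid A F0 \<subseteq> forbid A F"
    proof
      fix y assume y: "y \<in> forbid A F0"
      have "P p 0 = Q p 0" if pU: "p \<in> maps_on U A" and ap: "appears p (Some \<circ> y)" for p
      proof -
        have dp: "dom p = U" using pU by (simp add: maps_on_def)
        then obtain i where "\<forall>u\<in>U. (Some \<circ> y) (i + u) = p u" using ap by (auto simp: appears_def)
        then have "p = window U (Some \<circ> y) i"
          using dp by (auto simp: window_def restrict_map_def fun_eq_iff)
        then show ?thesis using gw[of "Some \<circ> y" i] Qw[of "Some \<circ> y" i] fP[OF y] by (simp add: g_def)
      qed
      then show "y \<in> forbid A F" using y by (auto simp: forbid_def F_def)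
    qed
  qed (auto simp: forbid_def F_def)
  have finF: "finite_patterns A F"
  proof -
    have "finite (maps_on U A)"
      using finite_set_of_finite_maps[OF \<open>finite U\<close> A(1)] by (simp add: maps_on_def)
    then show ?thesis
      using A(2) \<open>finite U\<close> by (auto simp: finite_patterns_def F_def)  (auto simp: maps_on_def)
  qed

  \<comment> \<open>The two factor maps\<close>
  define \<pi> where "\<pi> x i = g (window U (Some \<circ> x) i)" for x i
  define \<pi>' where "\<pi>' x i = g' (window U (Some \<circ> x) i)" for x i
  have winA: "window U (Some \<circ> x) i \<in> maps_on U A" if "x \<in> full_shift A" for x i
    using window_in_maps_on[OF full_shift_maps_on[OF that]] by simp
  have "\<pi> y = f y" "\<pi>' y = \<psi> (f y)" if "y \<in> forbid A F0" for y
    using fP[OF that] by (auto simp: \<pi>_def \<pi>'_def gw g'w)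
  then have "\<pi> ` forbid A F = T" "\<pi>' ` forbid A F = T'"
    using A(4) img by (auto simp: forbid_eq image_image[of \<psi> f, symmetric])
  moreover have "morphism A (full_shift A) B (full_shift B) \<pi>"
    "morphism A (full_shift A) B' (full_shift B') \<pi>'"
    unfolding \<pi>_def[abs_def] \<pi>'_def[abs_def]
    by (intro local_rule_morphism \<open>finite U\<close> gB g'B winA; assumption)+
  ultimately have fm: "factor_map A (forbid A F) B T \<pi>" "factor_map A (forbid A F) B' T' \<pi>'"
    by (auto simp: factor_map_def)
  have lr: "has_local_rule (full_shift A) \<pi> U g" "has_local_rule (full_shift A) \<pi>' U g'"
    using \<open>finite U\<close> by (auto simp: has_local_rule_def \<pi>_def \<pi>'_def)

  \<comment> \<open>Comparison of the speeds\<close>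
  have PQ: "P x p = Q x p" if x: "x \<in> approx_row G vs A F n" and p: "\<forall>u\<in>U. p + u \<in> strip G vs n" for x p n
  proof -
    have w: "window U x p \<in> maps_on U A"
      using x p by (intro window_in_maps_on) (auto simp: approx_row_def)
    have "appears (window U x p) x"
      unfolding appears_def by (intro exI[of _ p]) (auto simp: window_def restrict_map_def split: if_splits)
    \<comment> \<open>Here the added patterns act: a row need not extend to an element of the
      subshift, but its complete windows on \<open>U\<close> avoid \<open>F\<close>, so the
      reconstruction is correct at \<open>p\<close>.\<close>
    then have "window U x p \<notin> F" using x by (auto simp: approx_row_def)
    then show ?thesis using w gw[of x p] by (simp add: F_def Qw g_def)
  qed
  \<comment> \<open>The rule of the inverse recovers \<open>\<pi>\<close> from
    \<open>\<pi>'\<close>: on rows by \<open>PQ\<close>, on the subshift by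
    \<open>fP\<close>.\<close>
  have step1: "row_covered 0 G us vs A F U g k n" if "row_covered r' G us vs A F U g' (k + 2 * r) n" for k n
  proof (rule row_covered_factor[where K = M and h = s and q = r' and r = r and g = g'])
    show "row_covered (0 + r') G us vs A F U g' (k + 2 * r) n" using that by simp
    show "\<exists>a\<in>row_box us r. \<exists>b\<in>row_box vs r'. z = a + b" if "z \<in> M" for z using rr that by blast
    show "g (window U x p) = s (window M (\<lambda>p. Some (g' (window U x p))) p)"
      if "x \<in> approx_row G vs A F n" "\<forall>u\<in>U. p + u \<in> strip G vs n" for x p
      using PQ[OF that] by (simp add: gw g'w Q_def)
    show "g (window U (Some \<circ> y) p) = s (window M (\<lambda>p. Some (g' (window U (Some \<circ> y) p))) p)"
      if "y \<in> forbid A F" for y p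
      using fP(1,3)[of y] that by (simp add: forbid_eq gw g'w Q_def[symmetric])
  qed
  \<comment> \<open>In this direction \<open>P'\<close> is by definition a local function of
    \<open>P\<close>, on rows as well as on the subshift.\<close>
  have step2: "row_covered r' G us vs A F U g' (k + 2 * r) n"
    if "row_covered (2 * r') G us vs A F U g (k + 4 * r) n" for k n
  proof (rule row_covered_factor[where K = N and h = "\<lambda>p. into' (q p)" and q = r' and r = r and g = g])
    show "row_covered (r' + r') G us vs A F U g (k + 2 * r + 2 * r) n"
      using that by (simp add: mult_2[symmetric] algebra_simps)
    show "\<exists>a\<in>row_box us r. \<exists>b\<in>row_box vs r'. z = a + b" if "z \<in> N" for z using rr that by blast
  qed (auto simp: gw g'w P'_def)
  have "speed G us vs A F B U g k \<le> speed_row r' G us vs A F B' U g' (k + 2 * r) \<and>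
      speed_row r' G us vs A F B' U g' (k + 2 * r) \<le> speed_row (2 * r') G us vs A F B U g (k + 4 * r)" for k
  proof -
    \<comment> \<open>Compactness is applied to the longest words with the largest row; an
      \<open>n\<close> that suffices for them also suffices for the other two conditions, so all
      least values exist and are ordered.\<close>
    have ex: "\<exists>n. row_covered (2 * r') G us vs A F U g (k + 4 * r) n"
      using row_covered_exists[OF A(1) finF \<open>finite U\<close>] .
    define n3 where "n3 = (LEAST n. row_covered (2 * r') G us vs A F U g (k + 4 * r) n)"
    define n2 where "n2 = (LEAST n. row_covered r' G us vs A F U g' (k + 2 * r) n)"
    have 3: "row_covered r' G us vs A F U g' (k + 2 * r) n3"
      using step2 LeastI_ex[OF ex] by (simp add: n3_def)
    then have "row_covered r' G us vs A F U g' (k + 2 * r) n2"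
      unfolding n2_def by (rule LeastI)
    then have "speed G us vs A F B U g k \<le> n2" by (intro speed_le step1)
    moreover have "n2 \<le> n3" using 3 unfolding n2_def by (rule Least_le)
    moreover have "speed_row r' G us vs A F B' U g' (k + 2 * r) = n2"
      unfolding n2_def using g'B by (rule speed_row_eq)
    moreover have "speed_row (2 * r') G us vs A F B U g (k + 4 * r) = n3"
      unfolding n3_def using gB by (rule speed_row_eq)
    ultimately show ?thesis by simp
  qed
  \<comment> \<open>Under this premise \<open>N\<close> and \<open>M\<close> were both chosen inside
    \<open>G\<close>, so their common extent along \<open>H\<close> is 0.\<close>
  moreover have "(\<exists>N\<subseteq>G. neighborhood T \<psi> N) \<and> (\<exists>N\<subseteq>G. neighborhood T' (inv_into T \<psi>) N) \<longrightarrow> r' = 0"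
    using NG MG r'0 by blast
  ultimately show ?thesis
    using A(1) finF fm lr
    by (intro exI[of _ A] exI[of _ F] exI[of _ \<pi>] exI[of _ U] exI[of _ g] exI[of _ \<pi>']
        exI[of _ g'] exI[of _ r] exI[of _ r'] conjI allI) auto
qed

end
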